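(* Let $(Z_t,X_t)_{t\ge 1}$ be the univariate discrete-time marked Hawkes process with base intensity $\nu>0$, exciting function $\alpha$ and i.i.d. positive marks $\ell_{t,j}$ of finite mean, with $\Vert\alpha\Vert_1\mathbb{E}[\ell_{1,1}]<1$ (as defined in the context), and let $N_t=\sum_{s=1}^{t}Z_s$. Then $$\frac{N_t}{t}\longrightarrow\frac{\nu}{1-\Vert\alpha\Vert_1\mathbb{E}[\ell_{1,1}]}$$ in probability as $t\to\infty$.
   Context: Univariate discrete-time marked Hawkes process. Let $\nu>0$, let $\alpha:\mathbb{N}\cup\{0\}\to\mathbb{R}_+$ be a positive function, and put $\Vert\alpha\Vert_1:=\sum_{t=1}^{\infty}\alpha(t)$. Let $(\ell_{t,j})_{t\ge1,\,j\ge1}$ be positive random variables, i.i.d. in both $t$ and $j$, with finite mean. Set $X_0=N_0=0$. For $t\ge1$ let $$\lambda_t:=\nu+\sum_{s=1}^{t-1}\alpha(s)X_{t-s}$$ (so $\lambda_1=\nu$). Let $\mathcal{F}_t=\sigma(Z_s,X_s:1\le s\le t)$ be the natural filtration, with $\mathcal{F}_0$ trivial. Conditionally on $\mathcal{F}_{t-1}$, $Z_t$ is a Poisson random variable with mean $\lambda_t$, and $$X_t:=\sum_{j=1}^{Z_t}\ell_{t,j},$$ where the marks $(\ell_{t,j})_{j\ge1}$ at time $t$ are independent of $\sigma(\mathcal{F}_{t-1},Z_t)$. Standing assumption: $\Vert\alpha\Vert_1\mathbb{E}[\ell_{1,1}]<1$. Define $N_t:=\sum_{s=1}^tZ_s$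 and $L_t:=\sum_{s=1}^tX_s$. *)

theory Defs
  imports "HOL-Probability.Probability"
begin

text \<open>
  Time \<open>t\<close> and mark number \<open>j\<close> both start at 1; values of \<open>Z\<close> and \<open>mark\<close> at index 0 are junk
  that nothing below refers to. The aggregate marks \<open>X\<close> and the intensity \<open>\<lambda>\<close> are not
  separate data: they are functions of the counts \<open>Z\<close> and the individual marks.
\<close>

definition hawkes_marks :: "(nat \<Rightarrow> nat \<Rightarrow> 'a \<Rightarrow> real) \<Rightarrow> (nat \<Rightarrow> 'a \<Rightarrow> nat) \<Rightarrow> nat \<Rightarrow> 'a \<Rightarrow> real"
  where "hawkes_marks mark Z t \<omega> = (if t = 0 then 0 else \<Sum>j = 1..Z t \<omega>. mark t j \<omega>)"

definition hawkes_intensity ::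
    "real \<Rightarrow> (nat \<Rightarrow> real) \<Rightarrow> (nat \<Rightarrow> nat \<Rightarrow> 'a \<Rightarrow> real) \<Rightarrow> (nat \<Rightarrow> 'a \<Rightarrow> nat) \<Rightarrow> nat \<Rightarrow> 'a \<Rightarrow> real"
  where "hawkes_intensity \<nu> \<alpha> mark Z t \<omega> = \<nu> + (\<Sum>s = 1..t - 1. \<alpha> s * hawkes_marks mark Z (t - s) \<omega>)"

definition hawkes_filtration ::
    "'a measure \<Rightarrow> (nat \<Rightarrow> nat \<Rightarrow> 'a \<Rightarrow> real) \<Rightarrow> (nat \<Rightarrow> 'a \<Rightarrow> nat) \<Rightarrow> nat \<Rightarrow> 'a measure"
  where "hawkes_filtration M mark Z t = sigma (space M)
    (\<Union>s\<in>{1..t}. {Z s -` A \<inter> space M | A. A \<in> sets (count_space UNIV)}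
                \<union> {hawkes_marks mark Z s -` B \<inter> space M | B. B \<in> sets borel})"

definition hawkes_count :: "(nat \<Rightarrow> 'a \<Rightarrow> nat) \<Rightarrow> nat \<Rightarrow> 'a \<Rightarrow> nat"
  where "hawkes_count Z t \<omega> = (\<Sum>s = 1..t. Z s \<omega>)"

text \<open>
  The value at 0 is not part of the norm. As \<open>suminf\<close> is only meaningful for summable
  sequences, uses of this norm come with an explicit summability assumption.
\<close>

definition l1_norm :: "(nat \<Rightarrow> real) \<Rightarrow> real"
  where "l1_norm \<alpha> = (\<Sum>t. \<alpha> (Suc t))"

text \<open>
  The conditional law of \<open>Z t\<close> given the past is expressed through the conditional probabilities
  of the events \<open>Z t = k\<close>. The constant \<open>poisson_pmf\<close> is only meaningful for positive rates;
  here the intensity is at least \<open>\<nu> > 0\<close> almost surely. In \<open>marks_indep_past\<close>, the whole family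
  of marks at time \<open>t\<close> is independent of the sigma-algebra generated by the past and \<open>Z t\<close>.
\<close>

locale marked_hawkes = prob_space M
  for M :: "'a measure" +
  fixes \<nu> :: real
    and \<alpha> :: "nat \<Rightarrow> real"
    and mark :: "nat \<Rightarrow> nat \<Rightarrow> 'a \<Rightarrow> real"
    and Z :: "nat \<Rightarrow> 'a \<Rightarrow> nat"
  assumes base_pos: "0 < \<nu>"
    and exciting_pos: "\<And>t. 0 < \<alpha> t"
    and marks_pos: "\<And>t j. 1 \<le> t \<Longrightarrow> 1 \<le> j \<Longrightarrow> AE \<omega> in M. 0 < mark t j \<omega>"
    and marks_indep: "indep_vars (\<lambda>_. borel) (\<lambda>(t, j). mark t j) ({1..} \<times> {1..})"
    and marks_ident: "\<And>t j. 1 \<le> t \<Longrightarrow> 1 \<le> j \<Longrightarrow> distr M borel (mark t j) = distr M borel (mark 1 1)"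
    and marks_integrable: "integrable M (mark 1 1)"
    and counts_measurable: "\<And>t. 1 \<le> t \<Longrightarrow> Z t \<in> measurable M (count_space UNIV)"
    and counts_poisson: "\<And>t k. 1 \<le> t \<Longrightarrow>
      AE \<omega> in M. real_cond_exp M (hawkes_filtration M mark Z (t - 1))
                   (indicator {\<omega> \<in> space M. Z t \<omega> = k}) \<omega>
                 = pmf (poisson_pmf (hawkes_intensity \<nu> \<alpha> mark Z t \<omega>)) k"
    and marks_indep_past: "\<And>t. 1 \<le> t \<Longrightarrow> indep_set
      (sigma_sets (space M) {mark t j -` B \<inter> space M | j B. 1 \<le> j \<and> B \<in> sets borel})
      (sigma_sets (space M) (sets (hawkes_filtration M mark Z (t - 1))
         \<union> {Z t -` A \<inter> space M | A. A \<in> sets (count_space UNIV)}))"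

definition converges_in_probability ::
    "'a measure \<Rightarrow> (nat \<Rightarrow> 'a \<Rightarrow> real) \<Rightarrow> ('a \<Rightarrow> real) \<Rightarrow> bool"
  where "converges_in_probability M Y Y' \<longleftrightarrow>
    (\<forall>\<epsilon>>0. (\<lambda>t. measure M {\<omega> \<in> space M. \<bar>Y t \<omega> - Y' \<omega>\<bar> > \<epsilon>}) \<longlonglongrightarrow> 0)"

end

(*
  With a the norm of the exciting function, m the mean mark and R k the tail sum of the exciting
  function beyond k, summing the definition of the intensity over time gives
    (1 - a m) N_n - nu n
      = sum_t (Z_t - lambda_t) + a sum_t (X_t - m Z_t) - sum_u X_u R(n - u),
  and each term on the right is o(n) in L^1. All intensities have mean at most nu / (1 - a m), so
  the first sum is a martingale with bounded increments in L^2, and the last sum is a Cesaro mean of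
  a null sequence. The marks need not have a second moment, so in the middle sum they are truncated
  at level K: the truncated part, projected on the history, has orthogonal increments bounded in L^2,
  and the remainder is at most a constant times n E[mark; mark > K].
*)

theory Submission
  imports Defs
begin

section \<open>Martingale differences, independence and elementary series\<close>

text \<open>Neither counts nor intensities are assumed integrable. Conditional means are therefore
  computed as integrals of nonnegative functions, where finiteness need not be known, and an
  induction over time makes them real-valued afterwards. The history records only counts and
  aggregate marks, while truncation acts on single marks, so a truncated sum is in general not
  adapted. Projecting it by conditional expectation repairs this at no cost, as conditional
  expectation contracts both \<open>L^1\<close> and \<open>L^2\<close>. The projected increments
  stay centred because the marks at time \<open>t\<close> are independent of the earlier history
  joined with the count at \<open>t\<close>. The bound \<open>\<nu> / (1 - a m)\<close> on mean
  intensities is the fixed point of \<open>x = \<nu> + a m x\<close>. The level \<open>K\<close> is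
  chosen before \<open>n\<close> grows: only the truncation remainder is linear in \<open>n\<close>,
  and its coefficient tends to 0 as \<open>K\<close> grows because the marks have a finite
  mean.\<close>

lemma (in prob_space) expectation_abs_le_sqrt:
  fixes f :: "'a \<Rightarrow> real"
  assumes [measurable]: "f \<in> borel_measurable M" and sq: "integrable M (\<lambda>x. (f x)\<^sup>2)"
  shows "expectation (\<lambda>x. \<bar>f x\<bar>) \<le> sqrt (expectation (\<lambda>x. (f x)\<^sup>2))"
proof -
  have "integrable M f"
    by (rule square_integrable_imp_integrable) (use sq in auto)
  then have "variance (\<lambda>x. \<bar>f x\<bar>) = expectation (\<lambda>x. (f x)\<^sup>2) - (expectation (\<lambda>x. \<bar>f x\<bar>))\<^sup>2"
    using variance_eq[of "\<lambda>x. \<bar>f x\<bar>"] sq by simp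
  moreover have "0 \<le> variance (\<lambda>x. \<bar>f x\<bar>)"
    by (rule variance_positive)
  ultimately show ?thesis
    by (intro real_le_rsqrt) linarith
qed

lemma integrable_mult_of_squares:
  fixes f g :: "'a \<Rightarrow> real"
  assumes [measurable]: "f \<in> borel_measurable M" "g \<in> borel_measurable M"
    and "integrable M (\<lambda>x. (f x)\<^sup>2)" "integrable M (\<lambda>x. (g x)\<^sup>2)"
  shows "integrable M (\<lambda>x. f x * g x)"
proof (rule Bochner_Integration.integrable_bound)
  show "integrable M (\<lambda>x. (f x)\<^sup>2 + (g x)\<^sup>2)"
    using assms by simp
  have "\<bar>a * b\<bar> \<le> a\<^sup>2 + b\<^sup>2" for a b :: real
  proof -
    have "2 * \<bar>a * b\<bar> \<le> a\<^sup>2 + b\<^sup>2"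
      using sum_squares_bound[of "\<bar>a\<bar>" "\<bar>b\<bar>"] by (simp add: abs_mult)
    then show ?thesis by linarith
  qed
  then show "AE x in M. norm (f x * g x) \<le> norm ((f x)\<^sup>2 + (g x)\<^sup>2)"
    by simp
qed simp

text \<open>Pythagoras, needed at two scales: across times for martingale differences, and across
  the marks within a single time.\<close>

lemma orthogonal_sum_square:
  fixes d :: "'i \<Rightarrow> 'a \<Rightarrow> real"
  assumes fin: "finite I" and meas: "\<And>i. i \<in> I \<Longrightarrow> d i \<in> borel_measurable M"
    and sq: "\<And>i. i \<in> I \<Longrightarrow> integrable M (\<lambda>x. (d i x)\<^sup>2)"
    and orth: "\<And>i j. i \<in> I \<Longrightarrow> j \<in> I \<Longrightarrow> i \<noteq> j \<Longrightarrow> (\<integral>x. d i x * d j x \<partial>M) = 0"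
  shows "integrable M (\<lambda>x. (\<Sum>i\<in>I. d i x)\<^sup>2)"
    and "(\<integral>x. (\<Sum>i\<in>I. d i x)\<^sup>2 \<partial>M) = (\<Sum>i\<in>I. \<integral>x. (d i x)\<^sup>2 \<partial>M)"
proof -
  have int: "integrable M (\<lambda>x. d i x * d j x)" if "i \<in> I" "j \<in> I" for i j
    using that by (intro integrable_mult_of_squares meas sq)
  have eq: "(\<Sum>i\<in>I. d i x)\<^sup>2 = (\<Sum>i\<in>I. \<Sum>j\<in>I. d i x * d j x)" for x
    by (simp add: power2_eq_square sum_product)
  show "integrable M (\<lambda>x. (\<Sum>i\<in>I. d i x)\<^sup>2)"
    unfolding eq by (intro Bochner_Integration.integrable_sum int)
  have "(\<integral>x. (\<Sum>i\<in>I. d i x)\<^sup>2 \<partial>M) = (\<Sum>i\<in>I. \<Sum>j\<in>I. \<integral>x. d i x * d j x \<partial>M)"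
    unfolding eq using int by (simp add: Bochner_Integration.integral_sum)
  also have "\<dots> = (\<Sum>i\<in>I. \<Sum>j\<in>I. if j = i then \<integral>x. (d i x)\<^sup>2 \<partial>M else 0)"
    using orth by (intro sum.cong refl) (auto simp: power2_eq_square)
  also have "\<dots> = (\<Sum>i\<in>I. \<integral>x. (d i x)\<^sup>2 \<partial>M)"
    using fin by simp
  finally show "(\<integral>x. (\<Sum>i\<in>I. d i x)\<^sup>2 \<partial>M) = (\<Sum>i\<in>I. \<integral>x. (d i x)\<^sup>2 \<partial>M)" .
qed

lemma (in prob_space) sigma_finite_subalgebraI:
  assumes "subalgebra M G"
  shows "sigma_finite_subalgebra M G"
  by (intro finite_measure_subalgebra_is_sigma_finite finite_measure_subalgebra.intro
      finite_measure_subalgebra_axioms.intro assms finite_measure_axioms)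

text \<open>An earlier difference is known at time \<open>t - 1\<close>, so it can be pulled out of
  the conditional expectation of \<open>d t\<close>, which is zero. Cross terms vanish, second
  moments add up to at most \<open>B * n\<close>, and the variance of the absolute value being
  nonnegative brings this down to \<open>L^1\<close>. Centring is asked for as vanishing integrals
  over sets, the form in which it is obtained for counts and marks.\<close>

lemma (in prob_space) martingale_difference_L1_bound:
  fixes d :: "nat \<Rightarrow> 'a \<Rightarrow> real" and F :: "nat \<Rightarrow> 'a measure"
  assumes sub: "\<And>t. subalgebra M (F t)"
    and mono: "\<And>s t. s \<le> t \<Longrightarrow> sets (F s) \<subseteq> sets (F t)"
    and adapted: "\<And>t. 1 \<le> t \<Longrightarrow> d t \<in> borel_measurable (F t)"
    and centred: "\<And>t A. 1 \<le> t \<Longrightarrow> A \<in> sets (F (t - 1)) \<Longrightarrow> (\<integral>x\<in>A. d t x \<partial>M) = 0"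
    and sq: "\<And>t. 1 \<le> t \<Longrightarrow> integrable M (\<lambda>x. (d t x)\<^sup>2)"
    and bound: "\<And>t. 1 \<le> t \<Longrightarrow> expectation (\<lambda>x. (d t x)\<^sup>2) \<le> B"
  shows "expectation (\<lambda>x. \<bar>\<Sum>t = 1..n. d t x\<bar>) \<le> sqrt (B * n)"
proof -
  have meas: "d t \<in> borel_measurable M" if "1 \<le> t" for t
    using measurable_from_subalg[OF sub adapted[OF that]] .
  have int: "integrable M (d t)" if "1 \<le> t" for t
    using square_integrable_imp_integrable[OF meas sq] that by blast
  have orth_less: "expectation (\<lambda>x. d s x * d t x) = 0" if st: "1 \<le> s" "s < t" for s t
  proof -
    interpret G: sigma_finite_subalgebra M "F (t - 1)"
      by (intro sigma_finite_subalgebraI sub)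
    have "AE x in M. real_cond_exp M (F (t - 1)) (d t) x = 0"
      using st by (intro G.real_cond_exp_charact) (auto simp: centred int)
    moreover have "sets (F s) \<subseteq> sets (F (t - 1))"
      using st by (intro mono) auto
    then have ds: "d s \<in> borel_measurable (F (t - 1))"
      using measurable_from_subalg[of "F (t - 1)" "F s", OF _ adapted] sub st
      by (auto simp: subalgebra_def)
    have "expectation (\<lambda>x. d s x * real_cond_exp M (F (t - 1)) (d t) x) = expectation (\<lambda>x. d s x * d t x)"
      using st by (intro G.real_cond_exp_intg integrable_mult_of_squares meas sq ds) auto
    \<comment> \<open>The conditional expectation is replaced by 0, to which it is almost surely
      equal.\<close>
    moreover have "expectation (\<lambda>x. d s x * real_cond_exp M (F (t - 1)) (d t) x) = expectation (\<lambda>x. 0)"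
      using calculation(1) meas[OF st(1)] by (intro integral_cong_AE) auto
    ultimately show ?thesis by simp
  qed
  have orth: "expectation (\<lambda>x. d s x * d t x) = 0" if "s \<in> {1..n}" "t \<in> {1..n}" "s \<noteq> t" for s t
    using orth_less[of s t] orth_less[of t s] that by (cases "s < t") (auto simp: mult.commute)
  have sumsq: "integrable M (\<lambda>x. (\<Sum>t = 1..n. d t x)\<^sup>2)"
    "expectation (\<lambda>x. (\<Sum>t = 1..n. d t x)\<^sup>2) = (\<Sum>t = 1..n. expectation (\<lambda>x. (d t x)\<^sup>2))"
    using orthogonal_sum_square[of "{1..n}" d M] meas sq orth by auto
  have "expectation (\<lambda>x. \<bar>\<Sum>t = 1..n. d t x\<bar>) \<le> sqrt (expectation (\<lambda>x. (\<Sum>t = 1..n. d t x)\<^sup>2))"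
    using meas by (intro expectation_abs_le_sqrt sumsq) auto
  also have "\<dots> \<le> sqrt (B * n)"
    using sum_bounded_above[of "{1..n}" "\<lambda>t. expectation (\<lambda>x. (d t x)\<^sup>2)" B] bound sumsq(2)
    by (simp add: mult.commute)
  finally show ?thesis .
qed

section \<open>Independence and contraction by conditional expectation\<close>

text \<open>Independence of the two algebras passes to the smaller ones generated by
  \<open>f\<close> and by the indicator of \<open>B\<close>, where the product rule for integrable
  variables applies. In the uses below, \<open>G\<close> is generated by the marks of one time and
  \<open>H\<close> by all that precedes them.\<close>

lemma (in prob_space) indep_set_expectation_indicator:
  fixes f :: "'a \<Rightarrow> real"
  assumes indep: "indep_set (sets G) (sets H)" and space: "space G = space M" "space H = space M"
    and f: "f \<in> borel_measurable G" "integrable M f" and B: "B \<in> sets H"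
  shows "expectation (\<lambda>x. f x * indicator B x) = expectation f * prob B"
proof -
  have BM: "B \<in> events"
    using indep_setD_ev2[OF indep] B by blast
  have sub: "sigma_sets (space M) {g -` A \<inter> space M |A. A \<in> sets borel} \<subseteq> sets K"
    if "g \<in> borel_measurable K" "space K = space M" for g :: "'a \<Rightarrow> real" and K
    using measurable_sets[OF that(1)] that(2)
    by (intro sets.sigma_sets_subset[of _ K, unfolded that(2)]) auto
  have "indep_set (sigma_sets (space M) {f -` A \<inter> space M |A. A \<in> sets borel})
      (sigma_sets (space M) {(indicator B :: 'a \<Rightarrow> real) -` A \<inter> space M |A. A \<in> sets borel})"
    using indep sub[OF f(1) space(1)] sub[OF borel_measurable_indicator[OF B] space(2)]
    unfolding indep_sets2_eq by (meson subset_trans subsetD)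
  then have "indep_var borel f borel (indicator B :: 'a \<Rightarrow> real)"
    unfolding indep_var_eq using f(2) BM by simp
  from indep_var_lebesgue_integral[OF this f(2)] BM show ?thesis
    by (simp add: less_top[symmetric])
qed

text \<open>Contraction in \<open>L^1\<close>: the remainder left by truncation can be projected on
  the history without growing.\<close>

lemma (in prob_space) expectation_abs_real_cond_exp_le:
  assumes sub: "subalgebra M G" and f: "integrable M f"
  shows "expectation (\<lambda>x. \<bar>real_cond_exp M G f x\<bar>) \<le> expectation (\<lambda>x. \<bar>f x\<bar>)"
proof -
  interpret G: sigma_finite_subalgebra M G by (rule sigma_finite_subalgebraI[OF sub])
  have [measurable]: "f \<in> borel_measurable M" using f by auto
  have "ennreal (expectation (\<lambda>x. \<bar>real_cond_exp M G f x\<bar>)) = (\<integral>\<^sup>+x. \<bar>real_cond_exp M G f x\<bar> \<partial>M)"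
    using G.real_cond_exp_int(1)[OF f] by (intro nn_integral_eq_integral[symmetric]) auto
  also have "\<dots> \<le> (\<integral>\<^sup>+x. nn_cond_exp M G (\<lambda>x. ennreal \<bar>f x\<bar>) x \<partial>M)"
    by (intro nn_integral_mono_AE G.real_cond_exp_abs) simp
  also have "\<dots> = (\<integral>\<^sup>+x. ennreal \<bar>f x\<bar> \<partial>M)"
    using G.nn_cond_exp_intg[of "\<lambda>_. 1" "\<lambda>x. ennreal \<bar>f x\<bar>"] by simp
  also have "\<dots> = ennreal (expectation (\<lambda>x. \<bar>f x\<bar>))"
    using f by (intro nn_integral_eq_integral) auto
  finally show ?thesis
    by (simp add: ennreal_le_iff)
qed

text \<open>Contraction in \<open>L^2\<close>, by conditional Jensen: the bound on the truncated
  sums survives their projection.\<close>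

lemma (in prob_space) expectation_square_real_cond_exp_le:
  assumes sub: "subalgebra M G" and f[measurable]: "f \<in> borel_measurable M"
    and sq: "integrable M (\<lambda>x. (f x)\<^sup>2)"
  shows "integrable M (\<lambda>x. (real_cond_exp M G f x)\<^sup>2)"
    and "expectation (\<lambda>x. (real_cond_exp M G f x)\<^sup>2) \<le> expectation (\<lambda>x. (f x)\<^sup>2)"
proof -
  interpret G: sigma_finite_subalgebra M G by (rule sigma_finite_subalgebraI[OF sub])
  have "convex_on UNIV (\<lambda>x::real. x\<^sup>2)"
    by (rule convex_power2)
  then have jensen: "AE x in M. (real_cond_exp M G f x)\<^sup>2 \<le> real_cond_exp M G (\<lambda>x. (f x)\<^sup>2) x"
    \<comment> \<open>The two \<open>undefined\<close> stand for interval endpoints, which are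
      irrelevant on the whole line.\<close>
    using G.real_cond_exp_jensens_inequality(2)[of f UNIV undefined undefined "\<lambda>x. x\<^sup>2"] sq
      square_integrable_imp_integrable[OF f sq] by auto
  have int: "integrable M (real_cond_exp M G (\<lambda>x. (f x)\<^sup>2))"
    by (rule G.real_cond_exp_int(1)[OF sq])
  show *: "integrable M (\<lambda>x. (real_cond_exp M G f x)\<^sup>2)"
    by (rule Bochner_Integration.integrable_bound[OF int]) (use jensen in auto)
  have "expectation (\<lambda>x. (real_cond_exp M G f x)\<^sup>2) \<le> expectation (real_cond_exp M G (\<lambda>x. (f x)\<^sup>2))"
    by (rule integral_mono_AE[OF * int jensen])
  then show "expectation (\<lambda>x. (real_cond_exp M G f x)\<^sup>2) \<le> expectation (\<lambda>x. (f x)\<^sup>2)"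
    using G.real_cond_exp_int(2)[OF sq] by simp
qed

section \<open>Random sums, Poisson moments and summation identities\<close>

text \<open>Moves a random upper limit into indicators, so that each term of the series involves one
  fixed mark and the event that this mark is present.\<close>

lemma nonneg_sum_eq_suminf_ennreal:
  fixes f :: "nat \<Rightarrow> real"
  assumes "\<And>j. 0 \<le> f j"
  shows "ennreal (\<Sum>j = 1..n. f j) = (\<Sum>j. ennreal (f (Suc j)) * indicator {Suc j..} n)"
proof -
  have "(\<Sum>j. ennreal (f (Suc j)) * indicator {Suc j..} n) = (\<Sum>j<n. ennreal (f (Suc j)) * indicator {Suc j..} n)"
    by (intro suminf_finite) auto
  also have "\<dots> = (\<Sum>j<n. ennreal (f (Suc j)))"
    by (intro sum.cong) auto
  also have "\<dots> = ennreal (\<Sum>j = 1..n. f j)"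
    using assms by (simp add: sum_ennreal sum.atLeast1_atMost_eq)
  finally show ?thesis by simp
qed

text \<open>An index shift reduces \<open>k\<close> times the weight to \<open>r\<close> times the
  previous weight. Doing so twice gives the factorial moment \<open>r * r\<close> of
  \<open>k (k - 1)\<close>, and the variance follows by expanding the square.\<close>

lemma poisson_moments_sums:
  fixes r :: real
  shows "(\<lambda>k. real k * (r ^ k / fact k * exp (- r))) sums r"
    and "(\<lambda>k. (real k - r)\<^sup>2 * (r ^ k / fact k * exp (- r))) sums r"
proof -
  have "(\<lambda>k. r ^ k / fact k) sums exp r"
    using exp_converges[of r] by (simp add: scaleR_conv_of_real field_simps)
  from sums_mult2[OF this, of "exp (- r)"]
  have m0: "(\<lambda>k. r ^ k / fact k * exp (- r)) sums 1"
    by (simp add: mult_exp_exp)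
  have "(\<lambda>k. real (Suc k) * (r ^ Suc k / fact (Suc k) * exp (- r))) sums r"
    using sums_mult[OF m0, of r] by (simp add: field_simps del: of_nat_Suc)
  then show m1: "(\<lambda>k. real k * (r ^ k / fact k * exp (- r))) sums r"
    by (subst (asm) sums_Suc_iff) simp
  have "real (Suc k) * real k * (r ^ Suc k / fact (Suc k) * exp (- r)) = r * (real k * (r ^ k / fact k * exp (- r)))" for k
    by (simp add: field_simps del: of_nat_Suc)
  then have "(\<lambda>k. real (Suc k) * real k * (r ^ Suc k / fact (Suc k) * exp (- r))) sums (r * r)"
    by (simp only: sums_mult[OF m1])
  then have m2: "(\<lambda>k. real k * (real k - 1) * (r ^ k / fact k * exp (- r))) sums (r * r)"
    using sums_Suc_iff[of "\<lambda>k. real k * (real k - 1) * (r ^ k / fact k * exp (- r))" "r * r"] by simp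
  have "(real k - r)\<^sup>2 * q = real k * (real k - 1) * q + (1 - 2 * r) * (real k * q) + r\<^sup>2 * q" for k q
    by (simp add: power2_eq_square algebra_simps)
  then show "(\<lambda>k. (real k - r)\<^sup>2 * (r ^ k / fact k * exp (- r))) sums r"
    using sums_add[OF sums_add[OF m2 sums_mult[OF m1, of "1 - 2 * r"]] sums_mult[OF m0, of "r\<^sup>2"]]
    by (simp only:) (simp add: power2_eq_square algebra_simps)
qed

lemma cesaro_null:
  fixes R :: "nat \<Rightarrow> real"
  assumes "R \<longlonglongrightarrow> 0"
  shows "(\<lambda>n. (\<Sum>k<n. R k) / real n) \<longlonglongrightarrow> 0"
proof (rule LIMSEQ_I)
  fix e :: real assume "0 < e"
  then obtain N where N: "\<And>k. N \<le> k \<Longrightarrow> \<bar>R k\<bar> < e / 2"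
    using LIMSEQ_D[OF assms, of "e / 2"] by auto
  define S where "S = (\<Sum>k<N. \<bar>R k\<bar>)"
  \<comment> \<open>Beyond \<open>n0\<close> the initial block, of total size at most
    \<open>S\<close>, contributes less than \<open>e / 2\<close> to the mean.\<close>
  obtain n0 :: nat where n0: "2 * S / e < n0"
    using reals_Archimedean2 by blast
  show "\<exists>no. \<forall>n\<ge>no. norm ((\<Sum>k<n. R k) / real n - 0) < e"
  proof (intro exI allI impI)
    fix n assume n: "n \<ge> max N (Suc n0)"
    have "\<bar>\<Sum>k<n. R k\<bar> \<le> (\<Sum>k<n. \<bar>R k\<bar>)" by (rule sum_abs)
    also have "\<dots> = S + (\<Sum>k\<in>{N..<n}. \<bar>R k\<bar>)"
      unfolding S_def using n by (subst sum.union_disjoint[symmetric]) (auto intro!: sum.cong)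
    also have "(\<Sum>k\<in>{N..<n}. \<bar>R k\<bar>) \<le> real (card {N..<n}) * (e / 2)"
      using N by (intro sum_bounded_above) (auto intro: less_imp_le)
    also have "\<dots> \<le> real n * (e / 2)"
      using \<open>0 < e\<close> by (intro mult_right_mono) auto
    finally have "\<bar>\<Sum>k<n. R k\<bar> \<le> S + real n * (e / 2)" by simp
    moreover have "S < real n * (e / 2)"
    proof -
      have "2 * S / e < real n" using n0 n by linarith
      then show ?thesis using \<open>0 < e\<close> by (simp add: field_simps)
    qed
    ultimately have "\<bar>\<Sum>k<n. R k\<bar> < e * real n" by (simp add: field_simps)
    then show "norm ((\<Sum>k<n. R k) / real n - 0) < e"
      using n by (simp add: field_simps)
  qed
qed

text \<open>Regroups the excitation received up to time \<open>n\<close> by its source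
  \<open>u\<close>, whose lags run over \<open>1..n - u\<close>. Raising \<open>n\<close> by one
  adds one lag to each source; the new source \<open>Suc n\<close> has not acted yet.\<close>

lemma sum_convolution_swap:
  fixes a X :: "nat \<Rightarrow> real"
  shows "(\<Sum>t = 1..n. \<Sum>s = 1..t - 1. a s * X (t - s)) = (\<Sum>u = 1..n. X u * (\<Sum>s = 1..n - u. a s))"
proof (induction n)
  case (Suc n)
  have "(\<Sum>s = 1..n. a s * X (Suc n - s)) = (\<Sum>u = 1..n. X u * a (Suc n - u))"
    by (subst sum.atLeastAtMost_rev) (auto intro!: sum.cong)
  moreover have "(\<Sum>u = 1..n. X u * (\<Sum>s = 1..Suc n - u. a s))
      = (\<Sum>u = 1..n. X u * (\<Sum>s = 1..n - u. a s) + X u * a (Suc n - u))"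
    by (intro sum.cong) (auto simp: Suc_diff_le algebra_simps)
  ultimately show ?case
    using Suc by (simp add: sum.distrib)
qed simp

section \<open>Marked sums and their moments\<close>

text \<open>One notion for all the random sums below: \<open>h\<close> is the identity for the
  aggregate, the constant 1 for the count, a cut of the mark, or a centred cut.\<close>

definition marked_sum ::
    "(nat \<Rightarrow> nat \<Rightarrow> 'a \<Rightarrow> real) \<Rightarrow> (nat \<Rightarrow> 'a \<Rightarrow> nat) \<Rightarrow> (real \<Rightarrow> real) \<Rightarrow> nat \<Rightarrow> 'a \<Rightarrow> real"
  where "marked_sum mark Z h t \<omega> = (\<Sum>j = 1..Z t \<omega>. h (mark t j \<omega>))"

text \<open>Negative arguments are also sent to 0, so that the values are nonnegative everywhere
  and, for \<open>0 \<le> K\<close>, at most \<open>K\<close>, although marks are positive only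
  almost surely.\<close>

definition cut_below :: "real \<Rightarrow> real \<Rightarrow> real" where
  "cut_below K x = (if 0 \<le> x \<and> x \<le> K then x else 0)"

definition cut_above :: "real \<Rightarrow> real \<Rightarrow> real" where
  "cut_above K x = (if K < x then x else 0)"

lemma cut_measurable [measurable]:
  "cut_below K \<in> borel_measurable borel" "cut_above K \<in> borel_measurable borel"
  unfolding cut_below_def[abs_def] cut_above_def[abs_def] by measurable

context marked_hawkes
begin

section \<open>The sigma-algebras of the process and measurability\<close>

abbreviation "aggregate \<equiv> hawkes_marks mark Z"
abbreviation "intensity \<equiv> hawkes_intensity \<nu> \<alpha> mark Z"
abbreviation "past \<equiv> hawkes_filtration M mark Z"
abbreviation "msum \<equiv> marked_sum mark Z"

definition mark_algebra :: "nat \<Rightarrow> 'a measure" where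
  "mark_algebra t = sigma (space M) {mark t j -` B \<inter> space M | j B. 1 \<le> j \<and> B \<in> sets borel}"

text \<open>The information available once the count at \<open>t\<close> is drawn but before its
  marks are: exactly what the model makes independent of \<open>mark_algebra t\<close>.\<close>

definition count_algebra :: "nat \<Rightarrow> 'a measure" where
  "count_algebra t = sigma (space M) (sets (past (t - 1)) \<union> {Z t -` A \<inter> space M | A. A \<in> sets (count_space UNIV)})"

lemma mark_measurable: "1 \<le> t \<Longrightarrow> 1 \<le> j \<Longrightarrow> mark t j \<in> borel_measurable M"
  using marks_indep unfolding indep_vars_def by (auto dest!: bspec[of _ _ "(t, j)"])

lemma msum_measurable:
  assumes t: "1 \<le> t" and h: "h \<in> borel_measurable borel"
  shows "msum h t \<in> borel_measurable M"
proof -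
  have hm: "(\<lambda>\<omega>. h (mark t j \<omega>)) \<in> borel_measurable M" if "1 \<le> j" for j
    using mark_measurable[OF t that] h by (rule measurable_compose)
  have "(\<lambda>\<omega>. \<Sum>j = 1..n. h (mark t j \<omega>)) \<in> borel_measurable M" for n
    by (intro borel_measurable_sum hm) simp
  from measurable_compose_countable[OF this counts_measurable[OF t]]
  have "(\<lambda>\<omega>. \<Sum>j = 1..Z t \<omega>. h (mark t j \<omega>)) \<in> borel_measurable M" .
  then show ?thesis by (simp add: marked_sum_def[abs_def])
qed

lemma aggregate_eq_msum: "1 \<le> t \<Longrightarrow> aggregate t = msum (\<lambda>x. x) t"
  by (simp add: hawkes_marks_def marked_sum_def fun_eq_iff)

lemma aggregate_measurable: "aggregate t \<in> borel_measurable M"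
proof (cases "t = 0")
  case True
  then show ?thesis by (simp add: hawkes_marks_def[abs_def])
next
  case False
  then show ?thesis using msum_measurable[of t "\<lambda>x. x"] by (simp add: aggregate_eq_msum)
qed

lemma space_past [simp]: "space (past t) = space M"
  by (simp add: hawkes_filtration_def space_measure_of_conv)

lemma sets_past: "sets (past t) = sigma_sets (space M)
    (\<Union>s\<in>{1..t}. {Z s -` A \<inter> space M | A. A \<in> sets (count_space UNIV)}
                \<union> {aggregate s -` B \<inter> space M | B. B \<in> sets borel})"
  unfolding hawkes_filtration_def by (rule sets_measure_of) auto

lemma subalgebra_past: "subalgebra M (past t)"
proof -
  have "(\<Union>s\<in>{1..t}. {Z s -` A \<inter> space M | A. A \<in> sets (count_space UNIV)}
                \<union> {aggregate s -` B \<inter> space M | B. B \<in> sets borel}) \<subseteq> sets M"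
    using measurable_sets[OF counts_measurable] measurable_sets[OF aggregate_measurable] by auto
  then show ?thesis
    unfolding subalgebra_def sets_past by (simp add: sets.sigma_sets_subset)
qed

lemma past_mono: "s \<le> t \<Longrightarrow> sets (past s) \<subseteq> sets (past t)"
  unfolding sets_past by (intro sigma_sets_mono' UN_mono) auto

lemma counts_measurable_past:
  assumes "1 \<le> s" "s \<le> t" shows "Z s \<in> measurable (past t) (count_space UNIV)"
proof (rule measurableI)
  fix A assume "A \<in> sets (count_space (UNIV :: nat set))"
  then show "Z s -` A \<inter> space (past t) \<in> sets (past t)"
    using assms unfolding sets_past space_past
    by (intro sigma_sets.Basic UN_I[of s] UnI1 CollectI exI[of _ A]) auto
qed simp

lemma aggregate_measurable_past:
  assumes "1 \<le> s" "s \<le> t" shows "aggregate s \<in> borel_measurable (past t)"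
proof (rule measurableI)
  fix A :: "real set" assume "A \<in> sets borel"
  then show "aggregate s -` A \<inter> space (past t) \<in> sets (past t)"
    using assms unfolding sets_past space_past
    by (intro sigma_sets.Basic UN_I[of s] UnI2 CollectI exI[of _ A]) auto
qed simp

lemma intensity_measurable_past: "intensity t \<in> borel_measurable (past (t - 1))"
  unfolding hawkes_intensity_def[abs_def]
  by (intro borel_measurable_add borel_measurable_sum borel_measurable_times
      borel_measurable_const aggregate_measurable_past) auto

lemma intensity_measurable: "intensity t \<in> borel_measurable M"
  by (rule measurable_from_subalg[OF subalgebra_past intensity_measurable_past])

lemma AE_marks_pos: "AE \<omega> in M. \<forall>t\<ge>1. \<forall>j\<ge>1. 0 < mark t j \<omega>"
  using marks_pos by (simp add: AE_all_countable)

lemma AE_aggregate_nonneg: "AE \<omega> in M. \<forall>t. 0 \<le> aggregate t \<omega>"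
  using AE_marks_pos
proof eventually_elim
  case (elim \<omega>)
  then have "0 \<le> mark t j \<omega>" if "1 \<le> t" "1 \<le> j" for t j
    using that by (meson less_imp_le)
  then show ?case
    by (auto simp: hawkes_marks_def intro!: sum_nonneg)
qed

text \<open>Marks may be negative on a null set, hence the almost sure form. Positivity of the rate
  is what gives \<open>poisson_pmf\<close> its explicit formula.\<close>

lemma AE_intensity_ge: "AE \<omega> in M. \<nu> \<le> intensity t \<omega>"
  using AE_aggregate_nonneg
  by eventually_elim
    (auto simp: hawkes_intensity_def intro!: sum_nonneg mult_nonneg_nonneg less_imp_le[OF exciting_pos])

lemma space_mark_algebra [simp]: "space (mark_algebra t) = space M"
  and space_count_algebra [simp]: "space (count_algebra t) = space M"
  by (simp_all add: mark_algebra_def count_algebra_def space_measure_of_conv)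

lemma sets_mark_algebra: "sets (mark_algebra t) =
    sigma_sets (space M) {mark t j -` B \<inter> space M | j B. 1 \<le> j \<and> B \<in> sets borel}"
  unfolding mark_algebra_def by (rule sets_measure_of) auto

lemma mark_measurable_algebra:
  assumes "1 \<le> j" shows "mark t j \<in> borel_measurable (mark_algebra t)"
proof (rule measurableI)
  fix A :: "real set" assume "A \<in> sets borel"
  then show "mark t j -` A \<inter> space (mark_algebra t) \<in> sets (mark_algebra t)"
    using assms unfolding sets_mark_algebra space_mark_algebra
    by (intro sigma_sets.Basic CollectI exI[of _ j] exI[of _ A]) auto
qed simp

lemma sets_count_algebra: "sets (count_algebra t) =
    sigma_sets (space M) (sets (past (t - 1)) \<union> {Z t -` A \<inter> space M | A. A \<in> sets (count_space UNIV)})"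
  unfolding count_algebra_def using sets.space_closed[of "past (t - 1)"]
  by (intro sets_measure_of Un_least) auto

lemma past_subset_count_algebra: "sets (past (t - 1)) \<subseteq> sets (count_algebra t)"
  unfolding sets_count_algebra by auto

lemma count_measurable_algebra: "Z t \<in> measurable (count_algebra t) (count_space UNIV)"
proof (rule measurableI)
  fix A assume "A \<in> sets (count_space (UNIV :: nat set))"
  then show "Z t -` A \<inter> space (count_algebra t) \<in> sets (count_algebra t)"
    unfolding sets_count_algebra space_count_algebra
    by (intro sigma_sets.Basic UnI2 CollectI exI[of _ A]) auto
qed simp

lemma indep_algebras:
  assumes "1 \<le> t" shows "indep_set (sets (mark_algebra t)) (sets (count_algebra t))"
  using marks_indep_past[OF assms] by (simp only: sets_mark_algebra sets_count_algebra)

lemma count_algebra_events: "1 \<le> t \<Longrightarrow> B \<in> sets (count_algebra t) \<Longrightarrow> B \<in> events"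
  using indep_setD_ev2[OF indep_algebras] by blast

lemma
  assumes "1 \<le> t" "1 \<le> j" and h: "h \<in> borel_measurable borel"
    and int: "integrable M (\<lambda>\<omega>. h (mark 1 1 \<omega>) :: real)"
  shows integrable_fun_mark: "integrable M (\<lambda>\<omega>. h (mark t j \<omega>))"
    and expectation_fun_mark: "expectation (\<lambda>\<omega>. h (mark t j \<omega>)) = expectation (\<lambda>\<omega>. h (mark 1 1 \<omega>))"
proof -
  have "integrable (distr M borel (mark 1 1)) h"
    using int h by (subst integrable_distr_eq) (auto intro: mark_measurable)
  then have "integrable (distr M borel (mark t j)) h"
    using marks_ident[OF assms(1,2)] by simp
  then show "integrable M (\<lambda>\<omega>. h (mark t j \<omega>))"
    using h mark_measurable[OF assms(1,2)] by (subst (asm) integrable_distr_eq) auto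
  have "expectation (\<lambda>\<omega>. h (mark t j \<omega>)) = integral\<^sup>L (distr M borel (mark t j)) h"
    using h mark_measurable[OF assms(1,2)] by (subst integral_distr) auto
  also have "\<dots> = expectation (\<lambda>\<omega>. h (mark 1 1 \<omega>))"
    using h mark_measurable[of 1 1] marks_ident[OF assms(1,2)] by (simp add: integral_distr)
  finally show "expectation (\<lambda>\<omega>. h (mark t j \<omega>)) = expectation (\<lambda>\<omega>. h (mark 1 1 \<omega>))" .
qed

section \<open>Wald's identity for marked sums\<close>

text \<open>Whether a mark with number \<open>Suc j\<close> is present is decided by the count, so
  \<open>C j\<close> lies in \<open>count_algebra t\<close> and is independent of that mark. Each
  term of the series then factors with the same mean. Extended values allow the count to have
  infinite mean here.\<close>

lemma nn_integral_msum:
  assumes t: "1 \<le> t" and h: "h \<in> borel_measurable borel" and nonneg: "\<And>x. 0 \<le> h x"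
    and int: "integrable M (\<lambda>\<omega>. h (mark 1 1 \<omega>))" and B: "B \<in> sets (count_algebra t)"
  shows "(\<integral>\<^sup>+\<omega>. indicator B \<omega> * ennreal (msum h t \<omega>) \<partial>M)
    = ennreal (expectation (\<lambda>\<omega>. h (mark 1 1 \<omega>))) * (\<integral>\<^sup>+\<omega>. indicator B \<omega> * ennreal (real (Z t \<omega>)) \<partial>M)"
proof -
  define C where "C j = B \<inter> {\<omega> \<in> space M. Suc j \<le> Z t \<omega>}" for j
  have "{\<omega> \<in> space M. Suc j \<le> Z t \<omega>} \<in> sets (count_algebra t)" for j
    using measurable_sets[OF count_measurable_algebra, of "{Suc j..}" t]
    by (simp add: vimage_def Int_def conj_commute)
  then have C: "C j \<in> sets (count_algebra t)" for j
    unfolding C_def using B by auto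
  note C_events = count_algebra_events[OF t C]
  have gen: "(\<integral>\<^sup>+\<omega>. indicator B \<omega> * ennreal (msum g t \<omega>) \<partial>M)
      = ennreal (expectation (\<lambda>\<omega>. g (mark 1 1 \<omega>))) * (\<Sum>j. ennreal (prob (C j)))"
    if g: "g \<in> borel_measurable borel" "\<And>x. 0 \<le> g x" "integrable M (\<lambda>\<omega>. g (mark 1 1 \<omega>))" for g
  proof -
    have meas: "(\<lambda>\<omega>. g (mark t (Suc j) \<omega>)) \<in> borel_measurable M" for j
      using integrable_fun_mark[OF t _ g(1,3), of "Suc j"] by auto
    have eq: "indicator B \<omega> * ennreal (msum g t \<omega>) = (\<Sum>j. ennreal (g (mark t (Suc j) \<omega>) * indicator (C j) \<omega>))"
      if "\<omega> \<in> space M" for \<omega>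
      using that unfolding marked_sum_def
      by (subst nonneg_sum_eq_suminf_ennreal)
        (auto simp: g C_def indicator_def ennreal_suminf_cmult[symmetric] simp del: ennreal_suminf_cmult intro!: suminf_cong)
    have each: "(\<integral>\<^sup>+\<omega>. ennreal (g (mark t (Suc j) \<omega>) * indicator (C j) \<omega>) \<partial>M)
        = ennreal (expectation (\<lambda>\<omega>. g (mark 1 1 \<omega>))) * ennreal (prob (C j))" for j
    proof -
      have "(\<integral>\<^sup>+\<omega>. ennreal (g (mark t (Suc j) \<omega>) * indicator (C j) \<omega>) \<partial>M)
          = ennreal (expectation (\<lambda>\<omega>. g (mark t (Suc j) \<omega>) * indicator (C j) \<omega>))"
        using C_events g integrable_fun_mark[OF t _ g(1,3), of "Suc j"]
        by (intro nn_integral_eq_integral integrable_real_mult_indicator) auto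
      also have "expectation (\<lambda>\<omega>. g (mark t (Suc j) \<omega>) * indicator (C j) \<omega>)
          = expectation (\<lambda>\<omega>. g (mark t (Suc j) \<omega>)) * prob (C j)"
        using integrable_fun_mark[OF t _ g(1,3), of "Suc j"] C
          measurable_compose[OF mark_measurable_algebra g(1)]
        by (intro indep_set_expectation_indicator[OF indep_algebras[OF t]]) auto
      also have "expectation (\<lambda>\<omega>. g (mark t (Suc j) \<omega>)) = expectation (\<lambda>\<omega>. g (mark 1 1 \<omega>))"
        using t g by (intro expectation_fun_mark) auto
      finally show ?thesis
        using g by (simp add: ennreal_mult)
    qed
    have "(\<integral>\<^sup>+\<omega>. indicator B \<omega> * ennreal (msum g t \<omega>) \<partial>M)
        = (\<integral>\<^sup>+\<omega>. (\<Sum>j. ennreal (g (mark t (Suc j) \<omega>) * indicator (C j) \<omega>)) \<partial>M)"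
      by (intro nn_integral_cong eq)
    also have "\<dots> = (\<Sum>j. \<integral>\<^sup>+\<omega>. ennreal (g (mark t (Suc j) \<omega>) * indicator (C j) \<omega>) \<partial>M)"
      using meas C_events by (intro nn_integral_suminf) auto
    finally show ?thesis
      by (simp add: each)
  qed
  \<comment> \<open>The constant function 1 turns the same formula into an evaluation of the series
    itself: it is the integral of the count over \<open>B\<close>.\<close>
  have "msum (\<lambda>_. 1) t \<omega> = real (Z t \<omega>)" for \<omega>
    by (simp add: marked_sum_def)
  then have "(\<integral>\<^sup>+\<omega>. indicator B \<omega> * ennreal (real (Z t \<omega>)) \<partial>M) = (\<Sum>j. ennreal (prob (C j)))"
    using gen[of "\<lambda>_. 1"] by (simp only: prob_space integrable_const borel_measurable_const
        zero_le_one lebesgue_integral_const scaleR_one ennreal_1 mult_1)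
  then show ?thesis
    by (simp only: gen[OF h nonneg int])
qed

lemma
  assumes t: "1 \<le> t" and h: "h \<in> borel_measurable borel" and nonneg: "\<And>x. 0 \<le> h x"
    and int: "integrable M (\<lambda>\<omega>. h (mark 1 1 \<omega>))" and intZ: "integrable M (\<lambda>\<omega>. real (Z t \<omega>))"
  shows integrable_msum: "integrable M (msum h t)"
    and set_integral_msum: "B \<in> sets (count_algebra t) \<Longrightarrow>
      (\<integral>\<omega>\<in>B. msum h t \<omega> \<partial>M) = expectation (\<lambda>\<omega>. h (mark 1 1 \<omega>)) * (\<integral>\<omega>\<in>B. real (Z t \<omega>) \<partial>M)"
proof -
  note [measurable] = msum_measurable[OF t h] counts_measurable[OF t]
  have ms_nonneg: "0 \<le> msum h t \<omega>" for \<omega>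
    unfolding marked_sum_def by (intro sum_nonneg nonneg)
  have "(\<integral>\<^sup>+\<omega>. ennreal (msum h t \<omega>) \<partial>M) = ennreal (expectation (\<lambda>\<omega>. h (mark 1 1 \<omega>))) * (\<integral>\<^sup>+\<omega>. ennreal (real (Z t \<omega>)) \<partial>M)"
  proof -
    have "(\<integral>\<^sup>+\<omega>. indicator (space M) \<omega> * f \<omega> \<partial>M) = (\<integral>\<^sup>+\<omega>. f \<omega> \<partial>M)" for f
      by (intro nn_integral_cong) auto
    then show ?thesis
      using nn_integral_msum[OF t h nonneg int, of "space M"] sets.top[of "count_algebra t"] by simp
  qed
  also have "\<dots> < \<infinity>"
    using intZ by (simp add: nn_integral_eq_integral ennreal_mult_less_top)
  finally show int_ms: "integrable M (msum h t)"
    using ms_nonneg by (intro integrableI_nonneg) auto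
  assume B: "B \<in> sets (count_algebra t)"
  note [measurable] = count_algebra_events[OF t B]
  have ennreal_ind: "indicator B \<omega> * ennreal y = ennreal (indicator B \<omega> * y)" for \<omega> and y :: real
    by (auto simp: indicator_def)
  have intB: "integrable M (\<lambda>\<omega>. indicator B \<omega> * f \<omega>)" if "integrable M f" for f :: "'a \<Rightarrow> real"
    using integrable_mult_indicator[OF count_algebra_events[OF t B] that] by simp
  have "ennreal (expectation (\<lambda>\<omega>. indicator B \<omega> * msum h t \<omega>))
      = ennreal (expectation (\<lambda>\<omega>. h (mark 1 1 \<omega>))) * ennreal (expectation (\<lambda>\<omega>. indicator B \<omega> * real (Z t \<omega>)))"
    using nn_integral_msum[OF t h nonneg int B] intB[OF int_ms] intB[OF intZ] ms_nonneg
    unfolding ennreal_ind by (subst (asm) (1 2) nn_integral_eq_integral) auto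
  also have "\<dots> = ennreal (expectation (\<lambda>\<omega>. h (mark 1 1 \<omega>)) * expectation (\<lambda>\<omega>. indicator B \<omega> * real (Z t \<omega>)))"
    using nonneg by (intro ennreal_mult[symmetric] integral_nonneg) auto
  finally have "expectation (\<lambda>\<omega>. indicator B \<omega> * msum h t \<omega>)
      = expectation (\<lambda>\<omega>. h (mark 1 1 \<omega>)) * expectation (\<lambda>\<omega>. indicator B \<omega> * real (Z t \<omega>))"
    using nonneg ms_nonneg by (subst (asm) ennreal_inj) (auto intro!: integral_nonneg mult_nonneg_nonneg)
  then show "(\<integral>\<omega>\<in>B. msum h t \<omega> \<partial>M) = expectation (\<lambda>\<omega>. h (mark 1 1 \<omega>)) * (\<integral>\<omega>\<in>B. real (Z t \<omega>) \<partial>M)"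
    by (simp add: set_lebesgue_integral_def)
qed

declare One_nat_def [simp del]

section \<open>The conditional Poisson law of the counts\<close>

text \<open>Restates the Poisson assumption for the nonnegative conditional expectation, which can
  be multiplied by any nonnegative function of the past without an integrability condition.\<close>

lemma AE_nn_cond_exp_count:
  assumes t: "1 \<le> t"
  shows "AE \<omega> in M. ennreal (intensity t \<omega> ^ k / fact k * exp (- intensity t \<omega>))
    = nn_cond_exp M (past (t - 1)) (indicator {\<omega> \<in> space M. Z t \<omega> = k}) \<omega>"
proof -
  interpret P: sigma_finite_subalgebra M "past (t - 1)"
    by (intro sigma_finite_subalgebraI subalgebra_past)
  define E where "E = {\<omega> \<in> space M. Z t \<omega> = k}"
  define q where "q = (\<lambda>\<omega>. intensity t \<omega> ^ k / fact k * exp (- intensity t \<omega>))"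
  have E [measurable]: "E \<in> events"
    using measurable_sets[OF counts_measurable[OF t], of "{k}"] by (simp add: E_def vimage_def Int_def conj_commute)
  have q_past [measurable]: "q \<in> borel_measurable (past (t - 1))"
    unfolding q_def using intensity_measurable_past[of t] by measurable
  have q_M [measurable]: "q \<in> borel_measurable M"
    by (rule measurable_from_subalg[OF subalgebra_past q_past])
  have q_nonneg: "AE \<omega> in M. 0 \<le> q \<omega>"
    using AE_intensity_ge[of t] by eventually_elim (use base_pos in \<open>auto simp: q_def\<close>)
  have q_eq: "AE \<omega> in M. real_cond_exp M (past (t - 1)) (indicator E) \<omega> = q \<omega>"
    using counts_poisson[OF t, of k] AE_intensity_ge[of t]
    by eventually_elim (use base_pos in \<open>auto simp: q_def E_def\<close>)
  have intE: "integrable M (indicator E :: 'a \<Rightarrow> real)"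
    by (simp add: less_top[symmetric])
  have int_q: "integrable M q"
    using P.real_cond_exp_int(1)[OF intE] q_eq by (subst integrable_cong_AE[symmetric, OF _ _ q_eq]) auto
  have "AE \<omega> in M. ennreal (q \<omega>) = nn_cond_exp M (past (t - 1)) (indicator E) \<omega>"
  proof (rule P.nn_cond_exp_charact)
    fix A assume A: "A \<in> sets (past (t - 1))"
    then have AM [measurable]: "A \<in> events"
      using subalgebra_past by (auto simp: subalgebra_def)
    have AE_intA: "AE \<omega> in M. indicator A \<omega> * real_cond_exp M (past (t - 1)) (indicator E) \<omega> = indicator A \<omega> * q \<omega>"
      using q_eq by eventually_elim simp
    have "(\<integral>\<^sup>+\<omega>\<in>A. indicator E \<omega> \<partial>M) = (\<integral>\<^sup>+\<omega>. ennreal (indicator A \<omega> * indicator E \<omega>) \<partial>M)"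
      by (intro nn_integral_cong) (auto simp: indicator_def)
    also have "\<dots> = ennreal (\<integral>\<omega>\<in>A. indicator E \<omega> \<partial>M)"
      using integrable_mult_indicator[OF AM intE] by (subst nn_integral_eq_integral) (auto simp: set_lebesgue_integral_def)
    also have "(\<integral>\<omega>\<in>A. indicator E \<omega> \<partial>M) = (\<integral>\<omega>\<in>A. real_cond_exp M (past (t - 1)) (indicator E) \<omega> \<partial>M)"
      by (rule P.real_cond_exp_intA[OF intE A])
    also have "\<dots> = (\<integral>\<omega>. indicator A \<omega> * q \<omega> \<partial>M)"
      unfolding set_lebesgue_integral_def using AE_intA by (intro integral_cong_AE) auto
    also have "ennreal \<dots> = (\<integral>\<^sup>+\<omega>. ennreal (indicator A \<omega> * q \<omega>) \<partial>M)"
      using integrable_mult_indicator[OF AM int_q] q_nonneg by (subst nn_integral_eq_integral) (auto elim: eventually_mono)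
    also have "\<dots> = (\<integral>\<^sup>+\<omega>\<in>A. ennreal (q \<omega>) \<partial>M)"
      by (intro nn_integral_cong) (auto simp: indicator_def)
    finally show "(\<integral>\<^sup>+\<omega>\<in>A. indicator E \<omega> \<partial>M) = (\<integral>\<^sup>+\<omega>\<in>A. ennreal (q \<omega>) \<partial>M)" .
  qed auto
  then show ?thesis by (simp add: q_def E_def)
qed

text \<open>Splits over the values of the count and replaces each indicator by its Poisson weight.
  The integrand may depend on the past as well as on the count, since the squared fluctuation
  contains the intensity.\<close>

lemma nn_integral_count:
  assumes t: "1 \<le> t" and g: "\<And>k. g k \<in> borel_measurable (past (t - 1))"
  shows "(\<integral>\<^sup>+\<omega>. g (Z t \<omega>) \<omega> \<partial>M)
    = (\<integral>\<^sup>+\<omega>. (\<Sum>k. g k \<omega> * ennreal (intensity t \<omega> ^ k / fact k * exp (- intensity t \<omega>))) \<partial>M)"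
proof -
  interpret P: sigma_finite_subalgebra M "past (t - 1)"
    by (intro sigma_finite_subalgebraI subalgebra_past)
  define E where "E k = {\<omega> \<in> space M. Z t \<omega> = k}" for k
  have E [measurable]: "E k \<in> events" for k
    using measurable_sets[OF counts_measurable[OF t], of "{k}"] by (simp add: E_def vimage_def Int_def conj_commute)
  have [measurable]: "g k \<in> borel_measurable M" for k
    by (rule measurable_from_subalg[OF subalgebra_past g])
  note [measurable] = intensity_measurable
  have eq: "g (Z t \<omega>) \<omega> = (\<Sum>k. g k \<omega> * indicator (E k) \<omega>)" if "\<omega> \<in> space M" for \<omega>
    using that by (subst suminf_finite[of "{Z t \<omega>}"]) (auto simp: E_def)
  have each: "(\<integral>\<^sup>+\<omega>. g k \<omega> * indicator (E k) \<omega> \<partial>M)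
      = (\<integral>\<^sup>+\<omega>. g k \<omega> * ennreal (intensity t \<omega> ^ k / fact k * exp (- intensity t \<omega>)) \<partial>M)" for k
  proof -
    have "(\<integral>\<^sup>+\<omega>. g k \<omega> * indicator (E k) \<omega> \<partial>M)
        = (\<integral>\<^sup>+\<omega>. g k \<omega> * nn_cond_exp M (past (t - 1)) (indicator (E k)) \<omega> \<partial>M)"
      by (intro P.nn_cond_exp_intg[symmetric] g) simp
    also have "\<dots> = (\<integral>\<^sup>+\<omega>. g k \<omega> * ennreal (intensity t \<omega> ^ k / fact k * exp (- intensity t \<omega>)) \<partial>M)"
      using AE_nn_cond_exp_count[OF t, of k]
      by (intro nn_integral_cong_AE) (auto simp: E_def elim!: eventually_mono)
    finally show ?thesis .
  qed
  have "(\<integral>\<^sup>+\<omega>. g (Z t \<omega>) \<omega> \<partial>M) = (\<integral>\<^sup>+\<omega>. (\<Sum>k. g k \<omega> * indicator (E k) \<omega>) \<partial>M)"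
    by (intro nn_integral_cong eq)
  also have "\<dots> = (\<Sum>k. \<integral>\<^sup>+\<omega>. g k \<omega> * indicator (E k) \<omega> \<partial>M)"
    by (intro nn_integral_suminf) simp
  also have "\<dots> = (\<integral>\<^sup>+\<omega>. (\<Sum>k. g k \<omega> * ennreal (intensity t \<omega> ^ k / fact k * exp (- intensity t \<omega>))) \<partial>M)"
    unfolding each by (intro nn_integral_suminf[symmetric]) simp
  finally show ?thesis .
qed

lemma suminf_poisson_ennreal:
  fixes r :: real
  assumes "0 \<le> r"
  shows "(\<Sum>k. ennreal (real k) * ennreal (r ^ k / fact k * exp (- r))) = ennreal r"
    and "(\<Sum>k. ennreal ((real k - r)\<^sup>2) * ennreal (r ^ k / fact k * exp (- r))) = ennreal r"
  using assms poisson_moments_sums[of r]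
  by (auto simp: ennreal_mult[symmetric] suminf_ennreal2 sums_iff)

lemma nn_integral_count_mean:
  assumes t: "1 \<le> t" and B: "B \<in> sets (past (t - 1))"
  shows "(\<integral>\<^sup>+\<omega>. indicator B \<omega> * ennreal (real (Z t \<omega>)) \<partial>M) = (\<integral>\<^sup>+\<omega>. indicator B \<omega> * ennreal (intensity t \<omega>) \<partial>M)"
proof -
  have "(\<integral>\<^sup>+\<omega>. indicator B \<omega> * ennreal (real (Z t \<omega>)) \<partial>M)
      = (\<integral>\<^sup>+\<omega>. (\<Sum>k. indicator B \<omega> * ennreal (real k) * ennreal (intensity t \<omega> ^ k / fact k * exp (- intensity t \<omega>))) \<partial>M)"
    using B by (intro nn_integral_count[OF t, where g = "\<lambda>k \<omega>. indicator B \<omega> * ennreal (real k)"]) auto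
  also have "\<dots> = (\<integral>\<^sup>+\<omega>. indicator B \<omega> * ennreal (intensity t \<omega>) \<partial>M)"
  proof (intro nn_integral_cong_AE)
    show "AE \<omega> in M. (\<Sum>k. indicator B \<omega> * ennreal (real k) * ennreal (intensity t \<omega> ^ k / fact k * exp (- intensity t \<omega>)))
        = indicator B \<omega> * ennreal (intensity t \<omega>)"
      using AE_intensity_ge[of t]
      by eventually_elim (use base_pos in \<open>simp add: mult.assoc suminf_poisson_ennreal del: times_divide_eq_left\<close>)
  qed
  finally show ?thesis .
qed

text \<open>The variance of a Poisson variable equals its mean, so a first moment of the intensity
  controls the squared fluctuation.\<close>

lemma nn_integral_count_variance:
  assumes t: "1 \<le> t"
  shows "(\<integral>\<^sup>+\<omega>. ennreal ((real (Z t \<omega>) - intensity t \<omega>)\<^sup>2) \<partial>M) = (\<integral>\<^sup>+\<omega>. ennreal (intensity t \<omega>) \<partial>M)"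
proof -
  have "(\<integral>\<^sup>+\<omega>. ennreal ((real (Z t \<omega>) - intensity t \<omega>)\<^sup>2) \<partial>M)
      = (\<integral>\<^sup>+\<omega>. (\<Sum>k. ennreal ((real k - intensity t \<omega>)\<^sup>2) * ennreal (intensity t \<omega> ^ k / fact k * exp (- intensity t \<omega>))) \<partial>M)"
    using intensity_measurable_past[of t]
    by (intro nn_integral_count[OF t, where g = "\<lambda>k \<omega>. ennreal ((real k - intensity t \<omega>)\<^sup>2)"]) auto
  also have "\<dots> = (\<integral>\<^sup>+\<omega>. ennreal (intensity t \<omega>) \<partial>M)"
  proof (intro nn_integral_cong_AE)
    show "AE \<omega> in M. (\<Sum>k. ennreal ((real k - intensity t \<omega>)\<^sup>2) * ennreal (intensity t \<omega> ^ k / fact k * exp (- intensity t \<omega>)))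
        = ennreal (intensity t \<omega>)"
      using AE_intensity_ge[of t]
      by eventually_elim (use base_pos in \<open>simp add: suminf_poisson_ennreal del: times_divide_eq_left\<close>)
  qed
  finally show ?thesis .
qed

text \<open>Real-valued forms of the preceding identities. All rest on integrability of the
  intensity, the property that the later induction over time propagates.\<close>

lemma
  assumes t: "1 \<le> t" and int: "integrable M (intensity t)"
  shows integrable_count: "integrable M (\<lambda>\<omega>. real (Z t \<omega>))"
    and set_integral_count: "B \<in> sets (past (t - 1)) \<Longrightarrow>
      (\<integral>\<omega>\<in>B. real (Z t \<omega>) \<partial>M) = (\<integral>\<omega>\<in>B. intensity t \<omega> \<partial>M)"
    and integrable_count_variance: "integrable M (\<lambda>\<omega>. (real (Z t \<omega>) - intensity t \<omega>)\<^sup>2)"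
    and expectation_count_variance:
      "expectation (\<lambda>\<omega>. (real (Z t \<omega>) - intensity t \<omega>)\<^sup>2) = expectation (intensity t)"
proof -
  note [measurable] = counts_measurable[OF t] intensity_measurable
  have pos: "AE \<omega> in M. 0 \<le> intensity t \<omega>"
    using AE_intensity_ge[of t] by eventually_elim (use base_pos in simp)
  have int_nn: "(\<integral>\<^sup>+\<omega>. ennreal (intensity t \<omega>) \<partial>M) = ennreal (expectation (intensity t))"
    using int pos by (rule nn_integral_eq_integral)
  have ind_space: "(\<integral>\<^sup>+\<omega>. indicator (space M) \<omega> * f \<omega> \<partial>M) = (\<integral>\<^sup>+\<omega>. f \<omega> \<partial>M)" for f
    by (intro nn_integral_cong) auto
  have "(\<integral>\<^sup>+\<omega>. ennreal (real (Z t \<omega>)) \<partial>M) = ennreal (expectation (intensity t))"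
    using nn_integral_count_mean[OF t, of "space M"] sets.top[of "past (t - 1)"] by (simp add: ind_space int_nn)
  then show intZ: "integrable M (\<lambda>\<omega>. real (Z t \<omega>))"
    by (intro integrableI_nonneg) auto
  show var: "integrable M (\<lambda>\<omega>. (real (Z t \<omega>) - intensity t \<omega>)\<^sup>2)"
    using nn_integral_count_variance[OF t] int_nn by (intro integrableI_nonneg) auto
  have "ennreal (expectation (\<lambda>\<omega>. (real (Z t \<omega>) - intensity t \<omega>)\<^sup>2)) = ennreal (expectation (intensity t))"
    using nn_integral_count_variance[OF t] int_nn nn_integral_eq_integral[OF var] by simp
  then show "expectation (\<lambda>\<omega>. (real (Z t \<omega>) - intensity t \<omega>)\<^sup>2) = expectation (intensity t)"
    using pos by (subst (asm) ennreal_inj) (auto intro!: integral_nonneg_AE)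
  assume B: "B \<in> sets (past (t - 1))"
  then have BM: "B \<in> events"
    using subalgebra_past by (auto simp: subalgebra_def)
  have ennreal_ind: "indicator B \<omega> * ennreal y = ennreal (indicator B \<omega> * y)" for \<omega> and y :: real
    by (auto simp: indicator_def)
  have intB: "integrable M (\<lambda>\<omega>. indicator B \<omega> * f \<omega>)" if "integrable M f" for f :: "'a \<Rightarrow> real"
    using integrable_mult_indicator[OF BM that] by simp
  have posB: "AE \<omega> in M. 0 \<le> indicator B \<omega> * intensity t \<omega>"
    using pos by eventually_elim simp
  have "ennreal (expectation (\<lambda>\<omega>. indicator B \<omega> * real (Z t \<omega>))) = ennreal (expectation (\<lambda>\<omega>. indicator B \<omega> * intensity t \<omega>))"
    using nn_integral_count_mean[OF t B] intB[OF intZ] intB[OF int] posB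
    unfolding ennreal_ind by (subst (asm) (1 2) nn_integral_eq_integral) auto
  then have "expectation (\<lambda>\<omega>. indicator B \<omega> * real (Z t \<omega>)) = expectation (\<lambda>\<omega>. indicator B \<omega> * intensity t \<omega>)"
    using posB by (subst (asm) ennreal_inj) (auto intro!: integral_nonneg_AE)
  then show "(\<integral>\<omega>\<in>B. real (Z t \<omega>) \<partial>M) = (\<integral>\<omega>\<in>B. intensity t \<omega> \<partial>M)"
    by (simp add: set_lebesgue_integral_def)
qed

lemma expectation_count:
  assumes "1 \<le> t" and "integrable M (intensity t)"
  shows "expectation (\<lambda>\<omega>. real (Z t \<omega>)) = expectation (intensity t)"
  using set_integral_count[OF assms, of "space M"] sets.top[of "past (t - 1)"] by (simp add: set_integral_space assms integrable_count)

section \<open>The mean of the aggregate marks\<close>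

text \<open>Wald's identity asks for a function that is nonnegative everywhere; \<open>max 0\<close>
  provides one and changes the aggregate only on a null set.\<close>

lemma AE_aggregate_eq_msum_max:
  assumes "1 \<le> t" shows "AE \<omega> in M. aggregate t \<omega> = msum (max 0) t \<omega>"
  using AE_marks_pos
proof eventually_elim
  case (elim \<omega>)
  then have "max 0 (mark t j \<omega>) = mark t j \<omega>" if "1 \<le> j" for j
    using assms that by (simp add: less_imp_le)
  then show ?case
    using assms by (simp add: aggregate_eq_msum marked_sum_def)
qed

lemma
  assumes t: "1 \<le> t" and int: "integrable M (intensity t)"
  shows integrable_aggregate: "integrable M (aggregate t)"
    and expectation_aggregate:
      "expectation (aggregate t) = expectation (mark 1 1) * expectation (intensity t)"
proof -
  note intZ = integrable_count[OF t int]
  have int1: "integrable M (\<lambda>\<omega>. max 0 (mark 1 1 \<omega>))"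
    using marks_integrable by simp
  have E1: "expectation (\<lambda>\<omega>. max 0 (mark 1 1 \<omega>)) = expectation (mark 1 1)"
    using marks_integrable AE_marks_pos by (intro integral_cong_AE) (auto elim!: eventually_mono)
  have ms: "integrable M (msum (max 0) t)"
    using integrable_msum[OF t _ _ int1 intZ] by simp
  show "integrable M (aggregate t)"
    using AE_aggregate_eq_msum_max[OF t] ms
    by (subst integrable_cong_AE[of _ _ "msum (max 0) t"]) (auto simp: aggregate_measurable)
  have "expectation (aggregate t) = expectation (msum (max 0) t)"
    using AE_aggregate_eq_msum_max[OF t] ms by (intro integral_cong_AE) (auto simp: aggregate_measurable)
  also have "\<dots> = expectation (mark 1 1) * expectation (\<lambda>\<omega>. real (Z t \<omega>))"
    using set_integral_msum[OF t _ _ int1 intZ, of "space M"] sets.top[of "count_algebra t"] ms intZ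
    by (simp add: set_integral_space E1)
  finally show "expectation (aggregate t) = expectation (mark 1 1) * expectation (intensity t)"
    by (simp add: expectation_count[OF t int])
qed

lemma expectation_mark_nonneg: "0 \<le> expectation (mark 1 1)"
  using AE_marks_pos by (intro integral_nonneg_AE) (auto elim!: eventually_mono intro: less_imp_le)

section \<open>Second moments of centred bounded marks\<close>

text \<open>For a fixed number of marks: distinct marks of one time are independent and centred,
  hence orthogonal, and each square is at most the square of \<open>K\<close>.\<close>

lemma centred_sum_square:
  fixes g :: "real \<Rightarrow> real"
  assumes t: "1 \<le> t" and g [measurable]: "g \<in> borel_measurable borel" and bounded: "\<And>x. \<bar>g x\<bar> \<le> K"
    and centred: "expectation (\<lambda>\<omega>. g (mark 1 1 \<omega>)) = 0"
  shows "integrable M (\<lambda>\<omega>. (\<Sum>j = 1..z. g (mark t j \<omega>))\<^sup>2)"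
    and "expectation (\<lambda>\<omega>. (\<Sum>j = 1..z. g (mark t j \<omega>))\<^sup>2) \<le> K\<^sup>2 * real z"
proof -
  have meas: "(\<lambda>\<omega>. g (mark t j \<omega>)) \<in> borel_measurable M" if "1 \<le> j" for j
    using mark_measurable[OF t that] g by (rule measurable_compose)
  have int: "integrable M (\<lambda>\<omega>. g (mark t j \<omega>))" if "1 \<le> j" for j
    using meas[OF that] bounded by (intro integrable_const_bound[of _ K]) auto
  have sq_le: "(g x)\<^sup>2 \<le> K\<^sup>2" for x
    using bounded[of x] by (metis abs_ge_zero power2_abs power_mono)
  have sq: "integrable M (\<lambda>\<omega>. (g (mark t j \<omega>))\<^sup>2)" if "1 \<le> j" for j
    using meas[OF that] sq_le by (intro integrable_const_bound[of _ "K\<^sup>2"]) auto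
  have mean: "expectation (\<lambda>\<omega>. g (mark t j \<omega>)) = 0" if "1 \<le> j" for j
    using expectation_fun_mark[OF t that g] centred mark_measurable[of 1 1] bounded
    by (simp add: integrable_const_bound[of _ K])
  have orth: "expectation (\<lambda>\<omega>. g (mark t i \<omega>) * g (mark t j \<omega>)) = 0"
    if ij: "i \<in> {1..z}" "j \<in> {1..z}" "i \<noteq> j" for i j
  proof -
    let ?I = "{(t, i), (t, j)}" and ?Y = "\<lambda>p \<omega>. g ((case p of (t, j) \<Rightarrow> mark t j) \<omega>)"
    have "indep_vars (\<lambda>_. borel) (\<lambda>(t, j). mark t j) ?I"
      using t ij by (intro indep_vars_subset[OF marks_indep]) auto
    then have "indep_vars (\<lambda>_. borel) ?Y ?I"
      by (rule indep_vars_compose2) simp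
    then have "expectation (\<lambda>\<omega>. \<Prod>p\<in>?I. ?Y p \<omega>) = (\<Prod>p\<in>?I. expectation (?Y p))"
      using int ij by (intro indep_vars_lebesgue_integral) auto
    then show ?thesis
      using ij mean by simp
  qed
  show "integrable M (\<lambda>\<omega>. (\<Sum>j = 1..z. g (mark t j \<omega>))\<^sup>2)"
    using meas sq orth by (intro orthogonal_sum_square) auto
  have "expectation (\<lambda>\<omega>. (\<Sum>j = 1..z. g (mark t j \<omega>))\<^sup>2) = (\<Sum>j = 1..z. expectation (\<lambda>\<omega>. (g (mark t j \<omega>))\<^sup>2))"
    using meas sq orth by (intro orthogonal_sum_square) auto
  also have "\<dots> \<le> real (card {1..z}) * K\<^sup>2"
  proof (rule sum_bounded_above)
    fix j assume "j \<in> {1..z}"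
    then show "expectation (\<lambda>\<omega>. (g (mark t j \<omega>))\<^sup>2) \<le> K\<^sup>2"
      using sq sq_le by (intro integral_le_const) auto
  qed
  finally show "expectation (\<lambda>\<omega>. (\<Sum>j = 1..z. g (mark t j \<omega>))\<^sup>2) \<le> K\<^sup>2 * real z"
    by (simp add: mult.commute)
qed

text \<open>On the event that the count is \<open>z\<close> the sum has fixed length, and its square
  depends on the marks alone, which are independent of that event. Centring keeps the bound linear
  in \<open>z\<close>, so the mean of the count suffices.\<close>

lemma centred_msum_square:
  fixes g :: "real \<Rightarrow> real"
  assumes t: "1 \<le> t" and g: "g \<in> borel_measurable borel" and bounded: "\<And>x. \<bar>g x\<bar> \<le> K"
    and centred: "expectation (\<lambda>\<omega>. g (mark 1 1 \<omega>)) = 0" and intZ: "integrable M (\<lambda>\<omega>. real (Z t \<omega>))"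
  shows "integrable M (\<lambda>\<omega>. (msum g t \<omega>)\<^sup>2)"
    and "expectation (\<lambda>\<omega>. (msum g t \<omega>)\<^sup>2) \<le> K\<^sup>2 * expectation (\<lambda>\<omega>. real (Z t \<omega>))"
proof -
  define S where "S z \<omega> = (\<Sum>j = 1..z. g (mark t j \<omega>))\<^sup>2" for z \<omega>
  define E where "E z = {\<omega> \<in> space M. Z t \<omega> = z}" for z
  note S = centred_sum_square[OF t g bounded centred, folded S_def]
  have E: "E z \<in> sets (count_algebra t)" for z
    using measurable_sets[OF count_measurable_algebra, of "{z}" t] by (simp add: E_def vimage_def Int_def conj_commute)
  note E_events [measurable] = count_algebra_events[OF t E]
  have S_mark: "S z \<in> borel_measurable (mark_algebra t)" for z
  proof -
    have "(\<lambda>\<omega>. g (mark t j \<omega>)) \<in> borel_measurable (mark_algebra t)" if "1 \<le> j" for j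
      using mark_measurable_algebra[OF that] g by (rule measurable_compose)
    then show ?thesis
      unfolding S_def[abs_def] by (intro borel_measurable_power borel_measurable_sum) auto
  qed
  note [measurable] = borel_measurable_integrable[OF S(1)] msum_measurable[OF t g]
  have split: "c (Z t \<omega>) \<omega> = (\<Sum>z. c z \<omega> * indicator (E z) \<omega>)"
    if "\<omega> \<in> space M" for \<omega> and c :: "nat \<Rightarrow> 'a \<Rightarrow> ennreal"
    using that by (subst suminf_finite[of "{Z t \<omega>}"]) (auto simp: E_def)
  have ind: "ennreal y * indicator A \<omega> = ennreal (y * indicator A \<omega>)" for y A and \<omega> :: 'a
    by (auto simp: indicator_def)
  have each: "(\<integral>\<^sup>+\<omega>. ennreal (S z \<omega>) * indicator (E z) \<omega> \<partial>M)
      \<le> (\<integral>\<^sup>+\<omega>. ennreal (K\<^sup>2 * real z) * indicator (E z) \<omega> \<partial>M)" for z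
  proof -
    have "(\<integral>\<^sup>+\<omega>. ennreal (S z \<omega>) * indicator (E z) \<omega> \<partial>M) = ennreal (expectation (\<lambda>\<omega>. S z \<omega> * indicator (E z) \<omega>))"
      unfolding ind using integrable_real_mult_indicator[OF E_events S(1)]
      by (intro nn_integral_eq_integral) (auto simp: S_def)
    also have "expectation (\<lambda>\<omega>. S z \<omega> * indicator (E z) \<omega>) = expectation (S z) * prob (E z)"
      by (intro indep_set_expectation_indicator[OF indep_algebras[OF t]] S_mark S(1) E) auto
    also have "ennreal \<dots> \<le> ennreal (K\<^sup>2 * real z * prob (E z))"
      using S(2) by (intro ennreal_leI mult_right_mono) auto
    also have "\<dots> = (\<integral>\<^sup>+\<omega>. ennreal (K\<^sup>2 * real z) * indicator (E z) \<omega> \<partial>M)"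
      by (simp add: nn_integral_cmult_indicator emeasure_eq_measure ennreal_mult)
    finally show ?thesis .
  qed
  have "(\<integral>\<^sup>+\<omega>. ennreal ((msum g t \<omega>)\<^sup>2) \<partial>M) = (\<integral>\<^sup>+\<omega>. (\<Sum>z. ennreal (S z \<omega>) * indicator (E z) \<omega>) \<partial>M)"
    using split[of _ "\<lambda>z \<omega>. ennreal (S z \<omega>)"] by (intro nn_integral_cong) (simp add: S_def marked_sum_def)
  also have "\<dots> = (\<Sum>z. \<integral>\<^sup>+\<omega>. ennreal (S z \<omega>) * indicator (E z) \<omega> \<partial>M)"
    by (intro nn_integral_suminf) auto
  also have "\<dots> \<le> (\<Sum>z. \<integral>\<^sup>+\<omega>. ennreal (K\<^sup>2 * real z) * indicator (E z) \<omega> \<partial>M)"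
    by (intro suminf_le each) auto
  also have "\<dots> = (\<integral>\<^sup>+\<omega>. (\<Sum>z. ennreal (K\<^sup>2 * real z) * indicator (E z) \<omega>) \<partial>M)"
    by (intro nn_integral_suminf[symmetric]) auto
  also have "\<dots> = (\<integral>\<^sup>+\<omega>. ennreal (K\<^sup>2 * real (Z t \<omega>)) \<partial>M)"
    using split[of _ "\<lambda>z \<omega>. ennreal (K\<^sup>2 * real z)"] by (intro nn_integral_cong) simp
  also have "\<dots> = ennreal (K\<^sup>2 * expectation (\<lambda>\<omega>. real (Z t \<omega>)))"
    using intZ by (subst nn_integral_eq_integral) auto
  finally have le: "(\<integral>\<^sup>+\<omega>. ennreal ((msum g t \<omega>)\<^sup>2) \<partial>M) \<le> ennreal (K\<^sup>2 * expectation (\<lambda>\<omega>. real (Z t \<omega>)))" .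
  then show int: "integrable M (\<lambda>\<omega>. (msum g t \<omega>)\<^sup>2)"
    by (intro integrableI_nonneg) (auto simp: le_less_trans)
  have "ennreal (expectation (\<lambda>\<omega>. (msum g t \<omega>)\<^sup>2)) \<le> ennreal (K\<^sup>2 * expectation (\<lambda>\<omega>. real (Z t \<omega>)))"
    using le nn_integral_eq_integral[OF int] by simp
  then show "expectation (\<lambda>\<omega>. (msum g t \<omega>)\<^sup>2) \<le> K\<^sup>2 * expectation (\<lambda>\<omega>. real (Z t \<omega>))"
    by (simp add: ennreal_le_iff)
qed

section \<open>Truncation of the marks\<close>

lemma integrable_cut_mark:
  assumes "0 \<le> K"
  shows "integrable M (\<lambda>\<omega>. cut_below K (mark 1 1 \<omega>))" "integrable M (\<lambda>\<omega>. cut_above K (mark 1 1 \<omega>))"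
proof -
  have [measurable]: "mark 1 1 \<in> borel_measurable M" by (simp add: mark_measurable)
  show "integrable M (\<lambda>\<omega>. cut_below K (mark 1 1 \<omega>))" "integrable M (\<lambda>\<omega>. cut_above K (mark 1 1 \<omega>))"
    by (rule Bochner_Integration.integrable_bound[OF marks_integrable];
        auto simp: cut_below_def cut_above_def)+
qed

lemma expectation_cut_mark:
  assumes "0 \<le> K"
  shows "expectation (mark 1 1) = expectation (\<lambda>\<omega>. cut_below K (mark 1 1 \<omega>)) + expectation (\<lambda>\<omega>. cut_above K (mark 1 1 \<omega>))"
proof -
  have [measurable]: "mark 1 1 \<in> borel_measurable M" by (simp add: mark_measurable)
  have "AE \<omega> in M. mark 1 1 \<omega> = cut_below K (mark 1 1 \<omega>) + cut_above K (mark 1 1 \<omega>)"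
    using marks_pos[of 1 1, OF order_refl order_refl]
    by eventually_elim (use assms in \<open>auto simp: cut_below_def cut_above_def\<close>)
  then have "expectation (mark 1 1) = expectation (\<lambda>\<omega>. cut_below K (mark 1 1 \<omega>) + cut_above K (mark 1 1 \<omega>))"
    by (intro integral_cong_AE) auto
  then show ?thesis
    using integrable_cut_mark[OF assms] by simp
qed

text \<open>Every mark is eventually below the level, and its absolute value dominates the cut
  parts. This is how a finite mean does the work of a second moment.\<close>

lemma expectation_cut_above_tendsto_0:
  "(\<lambda>K. expectation (\<lambda>\<omega>. cut_above (real K) (mark 1 1 \<omega>))) \<longlonglongrightarrow> 0"
proof -
  have [measurable]: "mark 1 1 \<in> borel_measurable M" by (simp add: mark_measurable)
  have lim: "(\<lambda>K. cut_above (real K) x) \<longlonglongrightarrow> 0" for x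
  proof (rule tendsto_eventually)
    obtain n :: nat where "x \<le> real n" using real_arch_simple by blast
    then show "\<forall>\<^sub>F K in sequentially. cut_above (real K) x = 0"
      by (intro eventually_sequentiallyI[of n]) (auto simp: cut_above_def)
  qed
  have "(\<lambda>K. expectation (\<lambda>\<omega>. cut_above (real K) (mark 1 1 \<omega>))) \<longlonglongrightarrow> expectation (\<lambda>\<omega>. 0)"
    by (rule integral_dominated_convergence[where w = "\<lambda>\<omega>. \<bar>mark 1 1 \<omega>\<bar>"])
      (use marks_integrable lim in \<open>auto simp: cut_above_def\<close>)
  then show ?thesis by simp
qed

end

section \<open>The subcritical process\<close>

locale subcritical_marked_hawkes = marked_hawkes +
  assumes summable_exciting: "summable (\<lambda>t. \<alpha> (Suc t))"
    and subcritical: "l1_norm \<alpha> * expectation (mark 1 1) < 1"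
begin

text \<open>Solves \<open>rate = \<nu> + l1_norm \<alpha> * expectation (mark 1 1) * rate\<close>,
  the balance between base intensity and mean feedback. It serves both as the limit and as the
  uniform bound on mean intensities.\<close>

definition rate :: real where
  "rate = \<nu> / (1 - l1_norm \<alpha> * expectation (mark 1 1))"

lemma rate_pos: "0 < rate"
  unfolding rate_def using base_pos subcritical by simp

lemma sum_exciting_le: "(\<Sum>s = 1..k. \<alpha> s) \<le> l1_norm \<alpha>"
  unfolding l1_norm_def One_nat_def sum.atLeast1_atMost_eq
  using summable_exciting exciting_pos by (intro sum_le_suminf) (auto intro: less_imp_le)

text \<open>The intensity at \<open>t\<close> involves only earlier aggregates, whose means are at
  most the mean mark times \<open>rate\<close>; the fixed-point equation then reproduces the bound.
  Integrability travels in the same induction because the means of the aggregates depend on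
  it.\<close>

lemma integrable_intensity_and_le:
  assumes "1 \<le> t"
  shows "integrable M (intensity t) \<and> expectation (intensity t) \<le> rate"
  using assms
proof (induction t rule: less_induct)
  case (less t)
  have IH: "integrable M (aggregate (t - s))"
    "expectation (aggregate (t - s)) \<le> expectation (mark 1 1) * rate" if "s \<in> {1..t - 1}" for s
  proof -
    have *: "t - s < t" "1 \<le> t - s" using that by auto
    show "integrable M (aggregate (t - s))"
      using less.IH[OF *] by (intro integrable_aggregate *) auto
    have "expectation (aggregate (t - s)) = expectation (mark 1 1) * expectation (intensity (t - s))"
      using less.IH[OF *] by (intro expectation_aggregate *) auto
    also have "\<dots> \<le> expectation (mark 1 1) * rate"
      using less.IH[OF *] expectation_mark_nonneg by (intro mult_left_mono) auto
    finally show "expectation (aggregate (t - s)) \<le> expectation (mark 1 1) * rate" .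
  qed
  have int: "integrable M (\<lambda>\<omega>. \<Sum>s = 1..t - 1. \<alpha> s * aggregate (t - s) \<omega>)"
    using IH(1) by (intro Bochner_Integration.integrable_sum integrable_mult_right) auto
  have "expectation (intensity t) = \<nu> + (\<Sum>s = 1..t - 1. \<alpha> s * expectation (aggregate (t - s)))"
    unfolding hawkes_intensity_def[abs_def] using int IH(1)
    by (simp add: prob_space Bochner_Integration.integral_sum)
  also have "\<dots> \<le> \<nu> + (\<Sum>s = 1..t - 1. \<alpha> s * (expectation (mark 1 1) * rate))"
    using IH(2) exciting_pos by (intro add_left_mono sum_mono mult_left_mono) (auto intro: less_imp_le)
  also have "\<dots> \<le> \<nu> + l1_norm \<alpha> * (expectation (mark 1 1) * rate)"
    unfolding sum_distrib_right[symmetric] using expectation_mark_nonneg rate_pos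
    by (intro add_left_mono mult_right_mono sum_exciting_le) auto
  also have "\<dots> = rate"
    using subcritical by (simp add: rate_def field_simps)
  finally show ?case
    using int unfolding hawkes_intensity_def[abs_def] by simp
qed

lemmas integrable_intensity = integrable_intensity_and_le[THEN conjunct1]
lemmas expectation_intensity_le = integrable_intensity_and_le[THEN conjunct2]

lemma sets_past_imp_events: "B \<in> sets (past t) \<Longrightarrow> B \<in> events"
  using subalgebra_past by (auto simp: subalgebra_def)

section \<open>Fluctuations of the counts and of the marks\<close>

lemma count_fluctuation:
  "expectation (\<lambda>\<omega>. \<bar>\<Sum>t = 1..n. real (Z t \<omega>) - intensity t \<omega>\<bar>) \<le> sqrt (rate * n)"
proof (rule martingale_difference_L1_bound[where F = past])
  fix t :: nat and A assume t: "1 \<le> t"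
  note int = integrable_intensity[OF t]
  show "(\<lambda>\<omega>. real (Z t \<omega>) - intensity t \<omega>) \<in> borel_measurable (past t)"
  proof -
    have "intensity t \<in> borel_measurable (past t)"
      using measurable_from_subalg[OF _ intensity_measurable_past] past_mono[of "t - 1" t]
      by (auto simp: subalgebra_def)
    then show ?thesis
      using counts_measurable_past[OF t order_refl] by measurable
  qed
  show "integrable M (\<lambda>\<omega>. (real (Z t \<omega>) - intensity t \<omega>)\<^sup>2)"
    by (rule integrable_count_variance[OF t int])
  show "expectation (\<lambda>\<omega>. (real (Z t \<omega>) - intensity t \<omega>)\<^sup>2) \<le> rate"
    using expectation_count_variance[OF t int] expectation_intensity_le[OF t] by simp
  assume A: "A \<in> sets (past (t - 1))"
  have "set_integrable M A f" if "integrable M f" for f :: "'a \<Rightarrow> real"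
    using integrable_mult_indicator[OF sets_past_imp_events[OF A] that] by (simp add: set_integrable_def)
  then show "(\<integral>\<omega>\<in>A. real (Z t \<omega>) - intensity t \<omega> \<partial>M) = 0"
    using set_integral_count[OF t int A] integrable_count[OF t int] int
    by (subst set_integral_diff) auto
qed (auto intro: subalgebra_past dest: past_mono)

text \<open>The increment \<open>aggregate t - m * Z t\<close> is known at time \<open>t\<close>,
  hence equals its own projection, which splits into \<open>P t\<close> and the projection of
  \<open>R t\<close>. The \<open>P t\<close> form martingale differences bounded in
  \<open>L^2\<close>, giving the square root; the rest is estimated term by term in
  \<open>L^1\<close>, giving the part linear in \<open>n\<close>.\<close>

lemma mark_fluctuation:
  assumes K: "0 \<le> K"
  defines "m \<equiv> expectation (mark 1 1)" and "m' \<equiv> expectation (\<lambda>\<omega>. cut_above K (mark 1 1 \<omega>))"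
  shows "expectation (\<lambda>\<omega>. \<bar>\<Sum>t = 1..n. aggregate t \<omega> - m * real (Z t \<omega>)\<bar>)
    \<le> sqrt (K\<^sup>2 * rate * n) + 2 * m' * rate * n"
proof -
  define b where "b = expectation (\<lambda>\<omega>. cut_below K (mark 1 1 \<omega>))"
  have m: "m = b + m'"
    unfolding m_def b_def m'_def by (rule expectation_cut_mark[OF K])
  define D where "D t \<omega> = msum (cut_below K) t \<omega> - b * real (Z t \<omega>)" for t \<omega>
  define R where "R t \<omega> = aggregate t \<omega> - m * real (Z t \<omega>) - D t \<omega>" for t \<omega>
  \<comment> \<open>The truncated sum \<open>D t\<close> is not a function of \<open>Z t\<close> and \<open>X\<^sub>t\<close>, hence not measurable with
      respect to the history; its projection is.\<close>
  define P where "P t = real_cond_exp M (past t) (D t)" for t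
  have cut_nonneg: "0 \<le> cut_below K x" "0 \<le> cut_above K x" for x
    using K by (auto simp: cut_below_def cut_above_def)
  have m'_nonneg: "0 \<le> m'"
    unfolding m'_def using cut_nonneg by (intro Bochner_Integration.integral_nonneg) auto
  have intZ: "integrable M (\<lambda>\<omega>. real (Z t \<omega>))" and EZ: "expectation (\<lambda>\<omega>. real (Z t \<omega>)) \<le> rate"
    and int_agg: "integrable M (aggregate t)" if "1 \<le> t" for t
    using that integrable_intensity[OF that] expectation_intensity_le[OF that]
    by (simp_all add: integrable_count expectation_count integrable_aggregate)
  have below: "integrable M (msum (cut_below K) t)"
    and above: "integrable M (msum (cut_above K) t)" if "1 \<le> t" for t
    using integrable_msum[OF that _ _ integrable_cut_mark(1)[OF K] intZ[OF that]]
      integrable_msum[OF that _ _ integrable_cut_mark(2)[OF K] intZ[OF that]] cut_nonneg by auto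
  have int_D: "integrable M (D t)" if "1 \<le> t" for t
    unfolding D_def[abs_def] using below intZ that by auto
  have D_eq: "D t \<omega> = msum (\<lambda>x. cut_below K x - b) t \<omega>" for t \<omega>
    by (simp add: D_def marked_sum_def sum_subtractf mult.commute)
  have b_bounds: "0 \<le> b" "b \<le> K"
  proof -
    show "0 \<le> b" unfolding b_def using cut_nonneg by (intro Bochner_Integration.integral_nonneg) auto
    show "b \<le> K" unfolding b_def using integrable_cut_mark(1)[OF K] K
      by (intro integral_le_const) (auto simp: cut_below_def)
  qed
  \<comment> \<open>Both the cut mark and its mean lie between 0 and \<open>K\<close>, so centring
    does not enlarge the bound.\<close>
  have "\<bar>cut_below K x - b\<bar> \<le> K" for x
    using b_bounds K by (auto simp: cut_below_def)
  moreover have "expectation (\<lambda>\<omega>. cut_below K (mark 1 1 \<omega>) - b) = 0"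
    using integrable_cut_mark(1)[OF K] by (simp add: b_def prob_space)
  ultimately have sq_D: "integrable M (\<lambda>\<omega>. (D t \<omega>)\<^sup>2)"
    "expectation (\<lambda>\<omega>. (D t \<omega>)\<^sup>2) \<le> K\<^sup>2 * expectation (\<lambda>\<omega>. real (Z t \<omega>))" if "1 \<le> t" for t
    using centred_msum_square[OF that, of "\<lambda>x. cut_below K x - b" K] intZ[OF that] unfolding D_eq by auto
  have main: "expectation (\<lambda>\<omega>. \<bar>\<Sum>t = 1..n. P t \<omega>\<bar>) \<le> sqrt (K\<^sup>2 * rate * n)"
  proof (rule martingale_difference_L1_bound[where F = past])
    fix t :: nat and A assume t: "1 \<le> t"
    interpret F: sigma_finite_subalgebra M "past t"
      by (intro sigma_finite_subalgebraI subalgebra_past)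
    show "P t \<in> borel_measurable (past t)"
      by (simp add: P_def)
    note sq_P = expectation_square_real_cond_exp_le[OF subalgebra_past borel_measurable_integrable[OF int_D[OF t]] sq_D(1)[OF t],
        of t, folded P_def]
    show "integrable M (\<lambda>\<omega>. (P t \<omega>)\<^sup>2)" by (rule sq_P)
    have "expectation (\<lambda>\<omega>. (P t \<omega>)\<^sup>2) \<le> K\<^sup>2 * expectation (\<lambda>\<omega>. real (Z t \<omega>))"
      using sq_P(2) sq_D(2)[OF t] by linarith
    also have "\<dots> \<le> K\<^sup>2 * rate"
      using EZ[OF t] by (intro mult_left_mono) auto
    finally show "expectation (\<lambda>\<omega>. (P t \<omega>)\<^sup>2) \<le> K\<^sup>2 * rate" .
    assume A: "A \<in> sets (past (t - 1))"
    \<comment> \<open>Membership in \<open>past t\<close> lets \<open>D t\<close> replace its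
      projection under the integral over \<open>A\<close>; membership in
      \<open>count_algebra t\<close> lets Wald's identity make that integral vanish.\<close>
    then have "A \<in> sets (past t)" and A': "A \<in> sets (count_algebra t)"
      using past_mono[of "t - 1" t] past_subset_count_algebra by auto
    then have "(\<integral>\<omega>\<in>A. P t \<omega> \<partial>M) = (\<integral>\<omega>\<in>A. D t \<omega> \<partial>M)"
      unfolding P_def using F.real_cond_exp_intA[OF int_D[OF t]] by simp
    also have "\<dots> = (\<integral>\<omega>\<in>A. msum (cut_below K) t \<omega> \<partial>M) - b * (\<integral>\<omega>\<in>A. real (Z t \<omega>) \<partial>M)"
    proof -
      have "set_integrable M A f" if "integrable M f" for f :: "'a \<Rightarrow> real"
        using integrable_mult_indicator[OF sets_past_imp_events[OF A] that] by (simp add: set_integrable_def)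
      then show ?thesis
        unfolding D_def using below[OF t] intZ[OF t] by (subst set_integral_diff) auto
    qed
    also have "\<dots> = 0"
      using set_integral_msum[OF t _ _ integrable_cut_mark(1)[OF K] intZ[OF t] A'] cut_nonneg
      by (simp add: b_def)
    finally show "(\<integral>\<omega>\<in>A. P t \<omega> \<partial>M) = 0" .
  qed (auto intro: subalgebra_past dest: past_mono)
  have rest: "integrable M (P t)" "expectation (\<lambda>\<omega>. \<bar>aggregate t \<omega> - m * real (Z t \<omega>) - P t \<omega>\<bar>) \<le> 2 * m' * rate"
    if t: "1 \<le> t" for t
  proof -
    interpret F: sigma_finite_subalgebra M "past t"
      by (intro sigma_finite_subalgebraI subalgebra_past)
    have int_agg_Z: "integrable M (\<lambda>\<omega>. aggregate t \<omega> - m * real (Z t \<omega>))"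
      using int_agg[OF t] intZ[OF t] by simp
    have int_R: "integrable M (R t)"
      unfolding R_def[abs_def] using int_agg_Z int_D[OF t] by simp
    show "integrable M (P t)"
      unfolding P_def by (rule F.real_cond_exp_int(1)[OF int_D[OF t]])
    have past_meas: "(\<lambda>\<omega>. aggregate t \<omega> - m * real (Z t \<omega>)) \<in> borel_measurable (past t)"
      using aggregate_measurable_past[OF t order_refl] counts_measurable_past[OF t order_refl] by measurable
    \<comment> \<open>Conditioning on the history up to \<open>t\<close> leaves the aggregate and
      the count unchanged, so only the projection of \<open>R t\<close> remains.\<close>
    have "AE \<omega> in M. aggregate t \<omega> - m * real (Z t \<omega>) - P t \<omega> = real_cond_exp M (past t) (R t) \<omega>"
      using F.real_cond_exp_F_meas[OF int_agg_Z past_meas] F.real_cond_exp_diff[OF int_agg_Z int_D[OF t]]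
      unfolding P_def R_def[abs_def] by eventually_elim simp
    then have "expectation (\<lambda>\<omega>. \<bar>aggregate t \<omega> - m * real (Z t \<omega>) - P t \<omega>\<bar>)
        = expectation (\<lambda>\<omega>. \<bar>real_cond_exp M (past t) (R t) \<omega>\<bar>)"
      using int_agg_Z \<open>integrable M (P t)\<close> by (intro integral_cong_AE) auto
    also have "\<dots> \<le> expectation (\<lambda>\<omega>. \<bar>R t \<omega>\<bar>)"
      by (rule expectation_abs_real_cond_exp_le[OF subalgebra_past int_R])
    also have "\<dots> \<le> expectation (\<lambda>\<omega>. msum (cut_above K) t \<omega> + m' * real (Z t \<omega>))"
    proof (rule integral_mono_AE)
      show "AE \<omega> in M. \<bar>R t \<omega>\<bar> \<le> msum (cut_above K) t \<omega> + m' * real (Z t \<omega>)"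
        using AE_marks_pos
      proof eventually_elim
        case (elim \<omega>)
        then have "mark t j \<omega> = cut_below K (mark t j \<omega>) + cut_above K (mark t j \<omega>)" if "1 \<le> j" for j
          using t that K by (auto simp: cut_below_def cut_above_def not_le less_imp_le)
        then have "aggregate t \<omega> = msum (cut_below K) t \<omega> + msum (cut_above K) t \<omega>"
          using t by (simp add: aggregate_eq_msum marked_sum_def flip: sum.distrib)
        then have "R t \<omega> = msum (cut_above K) t \<omega> - m' * real (Z t \<omega>)"
          by (simp add: R_def D_def m algebra_simps)
        moreover have "0 \<le> msum (cut_above K) t \<omega>"
          unfolding marked_sum_def by (intro sum_nonneg cut_nonneg)
        moreover have "0 \<le> m' * real (Z t \<omega>)"
          using m'_nonneg by simp
        ultimately show ?case by linarith
      qed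
    qed (use int_R above[OF t] intZ[OF t] in auto)
    \<comment> \<open>The factor 2 counts the large marks once, by Wald's identity, and their
      subtracted mean once.\<close>
    also have "\<dots> = 2 * m' * expectation (\<lambda>\<omega>. real (Z t \<omega>))"
      using set_integral_msum[OF t _ _ integrable_cut_mark(2)[OF K] intZ[OF t], of "space M"] cut_nonneg
        sets.top[of "count_algebra t"] above[OF t] intZ[OF t]
      by (simp add: set_integral_space m'_def)
    also have "\<dots> \<le> 2 * m' * rate"
      using EZ[OF t] m'_nonneg by (intro mult_left_mono) auto
    finally show "expectation (\<lambda>\<omega>. \<bar>aggregate t \<omega> - m * real (Z t \<omega>) - P t \<omega>\<bar>) \<le> 2 * m' * rate" .
  qed
  have int_diff: "integrable M (\<lambda>\<omega>. \<bar>aggregate t \<omega> - m * real (Z t \<omega>) - P t \<omega>\<bar>)" if "1 \<le> t" for t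
    using int_agg[OF that] intZ[OF that] rest(1)[OF that] by simp
  have "expectation (\<lambda>\<omega>. \<bar>\<Sum>t = 1..n. aggregate t \<omega> - m * real (Z t \<omega>)\<bar>)
      \<le> expectation (\<lambda>\<omega>. \<bar>\<Sum>t = 1..n. P t \<omega>\<bar> + (\<Sum>t = 1..n. \<bar>aggregate t \<omega> - m * real (Z t \<omega>) - P t \<omega>\<bar>))"
  proof (rule integral_mono)
    fix \<omega>
    have "(\<Sum>t = 1..n. aggregate t \<omega> - m * real (Z t \<omega>))
        = (\<Sum>t = 1..n. P t \<omega>) + (\<Sum>t = 1..n. aggregate t \<omega> - m * real (Z t \<omega>) - P t \<omega>)"
      by (simp add: sum_subtractf)
    then show "\<bar>\<Sum>t = 1..n. aggregate t \<omega> - m * real (Z t \<omega>)\<bar>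
        \<le> \<bar>\<Sum>t = 1..n. P t \<omega>\<bar> + (\<Sum>t = 1..n. \<bar>aggregate t \<omega> - m * real (Z t \<omega>) - P t \<omega>\<bar>)"
      using sum_abs[of "\<lambda>t. aggregate t \<omega> - m * real (Z t \<omega>) - P t \<omega>" "{1..n}"] by linarith
  qed (use int_agg intZ rest(1) int_diff in \<open>auto intro!: Bochner_Integration.integrable_add
      Bochner_Integration.integrable_sum integrable_abs Bochner_Integration.integrable_diff integrable_mult_right\<close>)
  also have "\<dots> = expectation (\<lambda>\<omega>. \<bar>\<Sum>t = 1..n. P t \<omega>\<bar>)
      + (\<Sum>t = 1..n. expectation (\<lambda>\<omega>. \<bar>aggregate t \<omega> - m * real (Z t \<omega>) - P t \<omega>\<bar>))"
    using rest(1) int_agg intZ by (subst Bochner_Integration.integral_add)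
      (auto intro!: Bochner_Integration.integral_sum Bochner_Integration.integrable_sum integrable_abs)
  also have "\<dots> \<le> sqrt (K\<^sup>2 * rate * n) + real (card {1..n}) * (2 * m' * rate)"
    using rest(2) by (intro add_mono main sum_bounded_above) auto
  finally show ?thesis by (simp add: mult_ac)
qed

section \<open>Excitation not yet released and the decomposition of the count\<close>

text \<open>Written as a difference rather than a series, so that the decomposition of the count is
  an identity between finite sums.\<close>

definition exciting_tail :: "nat \<Rightarrow> real" where
  "exciting_tail k = l1_norm \<alpha> - (\<Sum>s = 1..k. \<alpha> s)"

lemma exciting_tail_nonneg: "0 \<le> exciting_tail k"
  using sum_exciting_le[of k] by (simp add: exciting_tail_def)

lemma exciting_tail_tendsto_0: "exciting_tail \<longlonglongrightarrow> 0"
proof -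
  have "(\<lambda>k. \<Sum>s<k. \<alpha> (Suc s)) \<longlonglongrightarrow> l1_norm \<alpha>"
    unfolding l1_norm_def by (rule summable_LIMSEQ[OF summable_exciting])
  from tendsto_diff[OF tendsto_const[of "l1_norm \<alpha>"] this] show ?thesis
    by (simp add: exciting_tail_def[abs_def] One_nat_def sum.atLeast1_atMost_eq)
qed

lemma l1_norm_nonneg: "0 \<le> l1_norm \<alpha>"
  using sum_exciting_le[of 0] by simp

text \<open>A pointwise identity, valid for any real \<open>m\<close>: by time \<open>n\<close> the
  aggregate at \<open>u\<close> has released all of its excitation except the share
  \<open>exciting_tail (n - u)\<close>.\<close>

lemma count_decomposition:
  "(1 - l1_norm \<alpha> * m) * real (hawkes_count Z n \<omega>) - \<nu> * n
    = (\<Sum>t = 1..n. real (Z t \<omega>) - intensity t \<omega>)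
      + l1_norm \<alpha> * (\<Sum>t = 1..n. aggregate t \<omega> - m * real (Z t \<omega>))
      - (\<Sum>u = 1..n. aggregate u \<omega> * exciting_tail (n - u))"
proof -
  have "(\<Sum>t = 1..n. intensity t \<omega>) = \<nu> * n + (\<Sum>u = 1..n. aggregate u \<omega> * (\<Sum>s = 1..n - u. \<alpha> s))"
    using sum_convolution_swap[of \<alpha> "\<lambda>t. aggregate t \<omega>" n]
    by (simp add: hawkes_intensity_def sum.distrib mult.commute)
  also have "(\<Sum>u = 1..n. aggregate u \<omega> * (\<Sum>s = 1..n - u. \<alpha> s))
      = l1_norm \<alpha> * (\<Sum>u = 1..n. aggregate u \<omega>) - (\<Sum>u = 1..n. aggregate u \<omega> * exciting_tail (n - u))"
    by (simp add: exciting_tail_def sum_distrib_left algebra_simps flip: sum_subtractf)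
  finally show ?thesis
    by (simp add: hawkes_count_def sum_subtractf algebra_simps flip: sum_distrib_left)
qed

text \<open>All terms are almost surely nonnegative, so the absolute value disappears and the
  uniform bound on the mean aggregates applies to each.\<close>

lemma history_remainder:
  "expectation (\<lambda>\<omega>. \<bar>\<Sum>u = 1..n. aggregate u \<omega> * exciting_tail (n - u)\<bar>)
    \<le> expectation (mark 1 1) * rate * (\<Sum>k<n. exciting_tail k)"
proof -
  have int: "integrable M (aggregate u)" and E: "expectation (aggregate u) \<le> expectation (mark 1 1) * rate"
    if "1 \<le> u" for u
    using that integrable_intensity[OF that] expectation_intensity_le[OF that] expectation_mark_nonneg
    by (auto simp: integrable_aggregate expectation_aggregate intro!: mult_left_mono)
  have "expectation (\<lambda>\<omega>. \<bar>\<Sum>u = 1..n. aggregate u \<omega> * exciting_tail (n - u)\<bar>)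
      = expectation (\<lambda>\<omega>. \<Sum>u = 1..n. aggregate u \<omega> * exciting_tail (n - u))"
  proof (rule integral_cong_AE)
    show "AE \<omega> in M. \<bar>\<Sum>u = 1..n. aggregate u \<omega> * exciting_tail (n - u)\<bar>
        = (\<Sum>u = 1..n. aggregate u \<omega> * exciting_tail (n - u))"
      using AE_aggregate_nonneg
      by eventually_elim (auto intro!: abs_of_nonneg sum_nonneg mult_nonneg_nonneg exciting_tail_nonneg)
  qed (auto intro!: borel_measurable_sum borel_measurable_times borel_measurable_abs aggregate_measurable)
  also have "\<dots> = (\<Sum>u = 1..n. expectation (aggregate u) * exciting_tail (n - u))"
    using int by (subst Bochner_Integration.integral_sum) auto
  also have "\<dots> \<le> (\<Sum>u = 1..n. expectation (mark 1 1) * rate * exciting_tail (n - u))"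
    using E exciting_tail_nonneg by (intro sum_mono mult_right_mono) auto
  \<comment> \<open>As \<open>u\<close> runs from 1 to \<open>n\<close>, the lag
    \<open>n - u\<close> runs through \<open>n - 1\<close> down to 0.\<close>
  also have "\<dots> = expectation (mark 1 1) * rate * (\<Sum>k<n. exciting_tail k)"
    by (simp add: sum_distrib_left[symmetric] sum.nat_diff_reindex[of exciting_tail, symmetric]
        One_nat_def sum.atLeast1_atMost_eq)
  finally show ?thesis .
qed

lemma integrable_hawkes_count: "integrable M (\<lambda>\<omega>. real (hawkes_count Z n \<omega>))"
  using integrable_count integrable_intensity by (auto simp: hawkes_count_def intro!: Bochner_Integration.integrable_sum)

text \<open>The level \<open>K\<close> is kept free: for fixed \<open>K\<close> every term on the
  right except the one with \<open>m'\<close> is of smaller order than \<open>n\<close>.\<close>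

lemma count_L1_bound:
  assumes K: "0 \<le> K"
  defines "m \<equiv> expectation (mark 1 1)" and "m' \<equiv> expectation (\<lambda>\<omega>. cut_above K (mark 1 1 \<omega>))"
  shows "expectation (\<lambda>\<omega>. \<bar>(1 - l1_norm \<alpha> * m) * real (hawkes_count Z n \<omega>) - \<nu> * n\<bar>)
    \<le> sqrt (rate * n) + l1_norm \<alpha> * (sqrt (K\<^sup>2 * rate * n) + 2 * m' * rate * n)
      + m * rate * (\<Sum>k<n. exciting_tail k)"
proof -
  define U where "U \<omega> = \<bar>\<Sum>t = 1..n. real (Z t \<omega>) - intensity t \<omega>\<bar>" for \<omega>
  define V where "V \<omega> = \<bar>\<Sum>t = 1..n. aggregate t \<omega> - m * real (Z t \<omega>)\<bar>" for \<omega>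
  define W where "W \<omega> = \<bar>\<Sum>u = 1..n. aggregate u \<omega> * exciting_tail (n - u)\<bar>" for \<omega>
  note int = integrable_count integrable_intensity integrable_aggregate
  have int_UVW: "integrable M U" "integrable M V" "integrable M W"
    unfolding U_def[abs_def] V_def[abs_def] W_def[abs_def] using int
    by (auto intro!: integrable_abs Bochner_Integration.integrable_sum Bochner_Integration.integrable_diff
        integrable_mult_left integrable_mult_right)
  have "expectation (\<lambda>\<omega>. \<bar>(1 - l1_norm \<alpha> * m) * real (hawkes_count Z n \<omega>) - \<nu> * n\<bar>)
      \<le> expectation (\<lambda>\<omega>. U \<omega> + l1_norm \<alpha> * V \<omega> + W \<omega>)"
  proof (rule integral_mono)
    fix \<omega>
    have "\<bar>a + c * b - d\<bar> \<le> \<bar>a\<bar> + c * \<bar>b\<bar> + \<bar>d\<bar>" if "0 \<le> c" for a b c d :: real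
      using abs_mult[of c b] that by linarith
    then show "\<bar>(1 - l1_norm \<alpha> * m) * real (hawkes_count Z n \<omega>) - \<nu> * n\<bar> \<le> U \<omega> + l1_norm \<alpha> * V \<omega> + W \<omega>"
      unfolding count_decomposition U_def V_def W_def using l1_norm_nonneg by blast
  qed (use int_UVW integrable_hawkes_count in auto)
  also have "\<dots> = expectation U + l1_norm \<alpha> * expectation V + expectation W"
    using int_UVW by simp
  also have "\<dots> \<le> sqrt (rate * n) + l1_norm \<alpha> * (sqrt (K\<^sup>2 * rate * n) + 2 * m' * rate * n)
      + m * rate * (\<Sum>k<n. exciting_tail k)"
    unfolding U_def[abs_def] V_def[abs_def] W_def[abs_def] m_def m'_def
    using l1_norm_nonneg by (intro add_mono mult_left_mono count_fluctuation mark_fluctuation[OF K] history_remainder)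
  finally show ?thesis .
qed

section \<open>Convergence in the mean and in probability\<close>

lemma count_L1_limit:
  "(\<lambda>n. expectation (\<lambda>\<omega>. \<bar>(1 - l1_norm \<alpha> * expectation (mark 1 1)) * real (hawkes_count Z n \<omega>) - \<nu> * n\<bar>) / n) \<longlonglongrightarrow> 0"
    (is "?f \<longlonglongrightarrow> 0")
proof (rule LIMSEQ_I)
  fix \<delta> :: real assume "0 < \<delta>"
  let ?a = "l1_norm \<alpha>" and ?m = "expectation (mark 1 1)"
    and ?m' = "\<lambda>K. expectation (\<lambda>\<omega>. cut_above (real K) (mark 1 1 \<omega>))"
  have "(\<lambda>K. ?a * (2 * ?m' K * rate)) \<longlonglongrightarrow> ?a * (2 * 0 * rate)"
    by (intro tendsto_intros expectation_cut_above_tendsto_0)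
  then have "(\<lambda>K. ?a * (2 * ?m' K * rate)) \<longlonglongrightarrow> 0"
    by simp
  from order_tendstoD(2)[OF this, of "\<delta> / 2"] \<open>0 < \<delta>\<close>
  \<comment> \<open>Division by \<open>n\<close> does not reduce this term, so it has to be made
    small through \<open>K\<close> before \<open>n\<close> is chosen.\<close>
  obtain K where K: "?a * (2 * ?m' K * rate) < \<delta> / 2"
    by (auto simp: eventually_sequentially)
  \<comment> \<open>What is left of the bound after division by \<open>n\<close>: both square-root
    terms, and the Cesaro mean of the tails.\<close>
  define g where "g n = (1 + ?a * K) * sqrt (rate / n) + ?m * rate * ((\<Sum>k<n. exciting_tail k) / n)" for n :: nat
  have "(\<lambda>n. rate / real n) \<longlonglongrightarrow> 0"
    by (rule lim_const_over_n)
  then have "(\<lambda>n. sqrt (rate / real n)) \<longlonglongrightarrow> sqrt 0"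
    by (rule tendsto_real_sqrt)
  then have "g \<longlonglongrightarrow> (1 + ?a * K) * sqrt 0 + ?m * rate * 0"
    unfolding g_def[abs_def] by (intro tendsto_intros cesaro_null exciting_tail_tendsto_0)
  then have "g \<longlonglongrightarrow> 0" by simp
  from order_tendstoD(2)[OF this, of "\<delta> / 2"] \<open>0 < \<delta>\<close>
  obtain N where N: "\<And>n. N \<le> n \<Longrightarrow> g n < \<delta> / 2"
    by (auto simp: eventually_sequentially)
  show "\<exists>no. \<forall>n\<ge>no. norm (?f n - 0) < \<delta>"
  proof (intro exI allI impI)
    fix n assume n: "n \<ge> max 1 N"
    have "?f n \<le> (sqrt (rate * n) + ?a * (sqrt ((real K)\<^sup>2 * rate * n) + 2 * ?m' K * rate * n)
      + ?m * rate * (\<Sum>k<n. exciting_tail k)) / n"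
      by (intro divide_right_mono count_L1_bound) auto
    also have "\<dots> = g n + ?a * (2 * ?m' K * rate)"
    proof -
      have "sqrt (rate / n) = sqrt (rate * n) / n"
        using n by (simp add: real_sqrt_divide real_sqrt_mult field_simps)
      then show ?thesis
        using n by (simp add: g_def real_sqrt_mult field_simps)
    qed
    also have "\<dots> < \<delta>"
      using K N[of n] n by linarith
    finally have "?f n < \<delta>" .
    moreover have "0 \<le> ?f n"
      by (intro divide_nonneg_nonneg Bochner_Integration.integral_nonneg) auto
    ultimately show "norm (?f n - 0) < \<delta>"
      unfolding diff_zero real_norm_def by (simp only: abs_of_nonneg)
  qed
qed

text \<open>Since \<open>c * rate = \<nu>\<close>, a deviation of the empirical rate beyond
  \<open>\<epsilon>\<close> forces the centred count to be at least
  \<open>\<epsilon> * c * n\<close> in absolute value. Markov's inequality then bounds the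
  probability by the normalised \<open>L^1\<close> norm.\<close>

theorem count_law_of_large_numbers:
  "converges_in_probability M (\<lambda>t \<omega>. real (hawkes_count Z t \<omega>) / real t) (\<lambda>_. rate)"
  unfolding converges_in_probability_def
proof (intro allI impI)
  fix \<epsilon> :: real assume "0 < \<epsilon>"
  define c where "c = 1 - l1_norm \<alpha> * expectation (mark 1 1)"
  have c: "0 < c" using subcritical by (simp add: c_def)
  define f where "f n = expectation (\<lambda>\<omega>. \<bar>c * real (hawkes_count Z n \<omega>) - \<nu> * n\<bar>) / n" for n :: nat
  have f: "f \<longlonglongrightarrow> 0"
    using count_L1_limit by (simp add: f_def[abs_def] c_def)
  have bound: "prob {\<omega> \<in> space M. \<epsilon> < \<bar>real (hawkes_count Z n \<omega>) / real n - rate\<bar>} \<le> f n / (c * \<epsilon>)"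
    if n: "1 \<le> n" for n
  proof -
    have int: "integrable M (\<lambda>\<omega>. \<bar>c * real (hawkes_count Z n \<omega>) - \<nu> * n\<bar>)"
      using integrable_hawkes_count by simp
    have "\<epsilon> * c * n \<le> \<bar>c * N - \<nu> * n\<bar>" if "\<epsilon> < \<bar>N / real n - rate\<bar>" for N :: real
    proof -
      have "c * rate = \<nu>"
        using c by (simp add: rate_def flip: c_def)
      then have "c * N - \<nu> * n = c * n * (N / real n - rate)"
        using n by (auto simp: field_simps)
      then have "\<bar>c * N - \<nu> * n\<bar> = \<bar>c * n * (N / real n - rate)\<bar>"
        by simp
      also have "\<dots> = c * n * \<bar>N / real n - rate\<bar>"
        using c by (simp add: abs_mult)
      also have "\<dots> \<ge> c * n * \<epsilon>"
        using that c by (intro mult_left_mono) auto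
      finally show ?thesis by (simp add: mult_ac)
    qed
    then have "prob {\<omega> \<in> space M. \<epsilon> < \<bar>real (hawkes_count Z n \<omega>) / real n - rate\<bar>}
        \<le> prob {\<omega> \<in> space M. \<epsilon> * c * n \<le> \<bar>c * real (hawkes_count Z n \<omega>) - \<nu> * n\<bar>}"
      using borel_measurable_integrable[OF int] by (intro finite_measure_mono) auto
    also have "\<dots> \<le> expectation (\<lambda>\<omega>. \<bar>c * real (hawkes_count Z n \<omega>) - \<nu> * n\<bar>) / (\<epsilon> * c * n)"
      using n c \<open>0 < \<epsilon>\<close> by (intro integral_Markov_inequality_measure[OF int, of "space M"]) auto
    finally show ?thesis
      by (simp add: f_def mult_ac)
  qed
  have "(\<lambda>n. f n / (c * \<epsilon>)) \<longlonglongrightarrow> 0 / (c * \<epsilon>)"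
    using c \<open>0 < \<epsilon>\<close> by (intro tendsto_intros f) auto
  then have lim: "(\<lambda>n. f n / (c * \<epsilon>)) \<longlonglongrightarrow> 0" by simp
  show "(\<lambda>n. prob {\<omega> \<in> space M. \<epsilon> < \<bar>real (hawkes_count Z n \<omega>) / real n - rate\<bar>}) \<longlonglongrightarrow> 0"
  proof (rule tendsto_sandwich[OF _ _ tendsto_const lim])
    \<comment> \<open>The bound is claimed from time 1 on: at time 0 the quotient is the default
      value 0 of division by zero and says nothing about the process.\<close>
    show "\<forall>\<^sub>F n in sequentially. prob {\<omega> \<in> space M. \<epsilon> < \<bar>real (hawkes_count Z n \<omega>) / real n - rate\<bar>} \<le> f n / (c * \<epsilon>)"
      using bound by (intro eventually_sequentiallyI[of 1])
  qed simp
qed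

end

theorem theorem2p1:
  fixes M :: "'a measure"
    and \<nu> :: real
    and \<alpha> :: "nat \<Rightarrow> real"
    and mark :: "nat \<Rightarrow> nat \<Rightarrow> 'a \<Rightarrow> real"
    and Z :: "nat \<Rightarrow> 'a \<Rightarrow> nat"
  assumes "marked_hawkes M \<nu> \<alpha> mark Z"
    and "summable (\<lambda>t. \<alpha> (Suc t))"
    and "l1_norm \<alpha> * integral\<^sup>L M (mark 1 1) < 1"
  shows "converges_in_probability M
    (\<lambda>t \<omega>. real (hawkes_count Z t \<omega>) / real t)
    (\<lambda>_. \<nu> / (1 - l1_norm \<alpha> * integral\<^sup>L M (mark 1 1)))"
proof -
  interpret subcritical_marked_hawkes M \<nu> \<alpha> mark Z
    by (intro subcritical_marked_hawkes.intro subcritical_marked_hawkes_axioms.intro assms)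
  show ?thesis
    using count_law_of_large_numbers by (simp add: rate_def)
qed

end
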